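(* There exists $n_0\in\mathbb{N}$ such that for every integer $n\geq n_0$ and every lattice packing $\Lambda+rB^n$ of $n$-dimensional balls (with $r>0$ and $\Lambda\subset\mathbb{R}^n$ a packing lattice of $rB^n$), there exists an affine plane $F\subset\mathbb{R}^n$ of dimension $\dim F\geq n/\log_2(n)$ which does not intersect any of the balls of the packing in their interior, i.e. $F\cap\mathrm{int}(b+rB^n)=\emptyset$ for all $b\in\Lambda$.
   Context: $B^n$ denotes the closed $n$-dimensional Euclidean unit ball centred at the origin. A lattice $\Lambda\subset\mathbb{R}^n$ is a set of the form $\Lambda=B\mathbb{Z}^n$ with $B\in\mathbb{R}^{n\times n}$, $\det B\neq 0$. For a $0$-symmetric convex body $K\subset\mathbb{R}^n$ with non-empty interior, a lattice $\Lambda$ is called a packing lattice of $K$ if $\mathrm{int}(b_1+K)\cap\mathrm{int}(b_2+K)=\emptyset$ for all $b_1\neq b_2\in\Lambda$. An affine plane means an affine subspace of $\mathbb{R}^n$. *)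

theory Defs
  imports "HOL-Analysis.Abstract_Metric_Spaces" "HOL-Analysis.L2_Norm"
    "Jordan_Normal_Form.VS_Connect"
begin

text \<open>
  The dimension \<open>n\<close> is quantified inside the statement, so Euclidean \<open>n\<close>-space is the carrier
  set \<open>carrier_vec n\<close> of real vectors rather than a type.
\<close>

definition eucl_dist :: "nat \<Rightarrow> real vec \<Rightarrow> real vec \<Rightarrow> real" where
  "eucl_dist n x y = L2_set (\<lambda>i. x $ i - y $ i) {..<n}"

lemma Metric_space_eucl_dist: "Metric_space (carrier_vec n) (eucl_dist n)"
proof
  fix x y z :: "real vec"
  show "0 \<le> eucl_dist n x y"
    by (simp add: eucl_dist_def)
  show "eucl_dist n x y = eucl_dist n y x"
    unfolding eucl_dist_def L2_set_def by (simp add: power2_commute)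
  show "(eucl_dist n x y = 0) = (x = y)"
    if "x \<in> carrier_vec n" "y \<in> carrier_vec n"
    using that by (auto simp: eucl_dist_def L2_set_eq_0_iff)
  have "L2_set (\<lambda>i. (x $ i - y $ i) + (y $ i - z $ i)) {..<n}
      \<le> L2_set (\<lambda>i. x $ i - y $ i) {..<n} + L2_set (\<lambda>i. y $ i - z $ i) {..<n}"
    by (rule L2_set_triangle_ineq)
  then show "eucl_dist n x z \<le> eucl_dist n x y + eucl_dist n y z"
    by (simp add: eucl_dist_def)
qed

definition eucl_interior :: "nat \<Rightarrow> real vec set \<Rightarrow> real vec set" where
  "eucl_interior n S = Metric_space.mtopology (carrier_vec n) (eucl_dist n) interior_of S"

definition unit_ball :: "nat \<Rightarrow> real vec set" where
  "unit_ball n = Metric_space.mcball (carrier_vec n) (eucl_dist n) (0\<^sub>v n) 1"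

definition scale_set :: "real \<Rightarrow> real vec set \<Rightarrow> real vec set" where
  "scale_set r S = (\<lambda>x. r \<cdot>\<^sub>v x) ` S"

definition translate :: "real vec \<Rightarrow> real vec set \<Rightarrow> real vec set" where
  "translate b S = (\<lambda>x. b + x) ` S"

definition is_lattice :: "nat \<Rightarrow> real vec set \<Rightarrow> bool" where
  "is_lattice n \<Lambda> \<longleftrightarrow>
     (\<exists>B \<in> carrier_mat n n. det B \<noteq> 0 \<and>
        \<Lambda> = (\<lambda>z. B *\<^sub>v map_vec real_of_int z) ` carrier_vec n)"

text \<open>Meant for 0-symmetric convex bodies \<open>K\<close> with non-empty interior, such as balls.\<close>

definition packing_lattice :: "nat \<Rightarrow> real vec set \<Rightarrow> real vec set \<Rightarrow> bool" where
  "packing_lattice n K \<Lambda> \<longleftrightarrow> is_lattice n \<Lambda> \<and>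
     (\<forall>b\<^sub>1\<in>\<Lambda>. \<forall>b\<^sub>2\<in>\<Lambda>. b\<^sub>1 \<noteq> b\<^sub>2 \<longrightarrow>
        eucl_interior n (translate b\<^sub>1 K) \<inter> eucl_interior n (translate b\<^sub>2 K) = {})"

definition affine_plane :: "nat \<Rightarrow> nat \<Rightarrow> real vec set \<Rightarrow> bool" where
  "affine_plane n d F \<longleftrightarrow>
     (\<exists>p \<in> carrier_vec n. \<exists>W.
        VectorSpace.subspace class_ring W (module_vec TYPE(real) n) \<and>
        vectorspace.dim class_ring ((module_vec TYPE(real) n)\<lparr>carrier := W\<rparr>) = d \<and>
        F = translate p W)"

end

theory Submission
  imports "HOL-Analysis.Ball_Volume" "HOL-Real_Asymp.Real_Asymp" "Jordan_Normal_Form.DL_Rank" Defs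
begin

text \<open>
  Let \<open>\<pi>\<^sub>j\<close> be the projection that forgets the first \<open>j\<close> coordinates. After orthogonal
  reflections the lattice contains vectors \<open>b\<^sub>0, \<dots>, b\<^bsub>d-1\<^esub>\<close> such that \<open>\<pi>\<^sub>j b\<^sub>j = l\<^sub>j e\<^sub>j\<close> is a
  shortest nonzero vector of \<open>\<pi>\<^sub>j \<Lambda>\<close> and \<open>\<pi>\<^bsub>j+1\<^esub> b\<^sub>j = 0\<close> (the start of a Hermite-Korkin-Zolotarev
  basis). Let \<open>l\<^sub>i\<close> be the largest of the \<open>l\<^sub>j\<close> with \<open>j < d\<close>; it is at least \<open>l\<^sub>0 \<ge> 2r\<close>.

  If every \<open>d\<close>-plane parallel to the first \<open>d\<close> coordinate axes met an open ball of the packing,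
  then the lattice translates of \<open>A = \<Prod>\<^bsub>j<d\<^esub> [0, l\<^sub>j) \<times> (l\<^sub>i/2) B\<^bsup>n-d\<^esup>\<close> would cover the space. On the
  other hand \<open>\<pi>\<^sub>i \<Lambda>\<close> has minimal distance \<open>l\<^sub>i\<close>, so by Blichfeldt's argument the translates of
  \<open>C = \<Prod>\<^bsub>j<i\<^esub> [0, l\<^sub>j) \<times> \<rho> B\<^bsup>n-i\<^esup>\<close> with \<open>\<rho>\<^sup>2 = (1 - 1/(2n)) l\<^sub>i\<^sup>2/2\<close> overlap at most \<open>2n\<close>-fold.
  Hence \<open>vol C \<le> 2n vol A\<close>, which simplifies to \<open>2\<^sup>n \<le> 8n\<^sup>2 (2(n+1)/\<pi>)\<^sup>d\<close>. This fails for
  \<open>d = \<lceil>n / log\<^sub>2 n\<rceil>\<close> and large \<open>n\<close>.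
\<close>

section \<open>Numerical estimates\<close>

text \<open>Midpoint log-convexity of Gamma between \<open>x\<close> and \<open>x + 1\<close>: the
  functional equation \<open>Gamma (x + 1) = x * Gamma x\<close> turns the geometric mean of the end
  values into \<open>sqrt x * Gamma x\<close>.\<close>

lemma Gamma_half_step:
  fixes x :: real
  assumes "x > 0"
  shows "Gamma (x + 1/2) \<le> sqrt x * Gamma x"
proof -
  have "(ln \<circ> Gamma) ((1 - 1/2) *\<^sub>R x + (1/2) *\<^sub>R (x + 1))
      \<le> (1 - 1/2) * (ln \<circ> Gamma) x + 1/2 * (ln \<circ> Gamma) (x + 1)"
    using assms by (intro convex_onD[OF log_convex_Gamma_real]) auto
  moreover have "(1 - 1/2) *\<^sub>R x + (1/2) *\<^sub>R (x + 1) = x + 1/2"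
    by (simp add: field_simps)
  moreover have "Gamma (x + 1) = x * Gamma x"
    using assms by (intro Gamma_plus1) (auto elim!: nonpos_Ints_cases)
  moreover have "Gamma x > 0" "Gamma (x + 1/2) > 0"
    using assms by (auto intro!: Gamma_real_pos)
  moreover from this have "ln (x * Gamma x) = ln x + ln (Gamma x)"
    "ln (sqrt x * Gamma x) = ln x / 2 + ln (Gamma x)"
    using assms by (auto simp: ln_mult_pos ln_sqrt)
  ultimately have "ln (Gamma (x + 1/2)) \<le> ln (sqrt x * Gamma x)"
    by (simp only: o_def) (simp add: field_simps)
  with \<open>Gamma x > 0\<close> \<open>Gamma (x + 1/2) > 0\<close> assms show ?thesis
    by (subst (asm) ln_le_cancel_iff) auto
qed

text \<open>With \<open>x = k / 2 + 1\<close> the quotient of the two volumes is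
  \<open>Gamma (x + 1/2) / (sqrt pi * Gamma x)\<close>, to which \<open>Gamma_half_step\<close>
  applies.\<close>

lemma unit_ball_vol_step:
  "unit_ball_vol (real k) \<le> sqrt ((real k + 2) / (2 * pi)) * unit_ball_vol (real (Suc k))"
proof -
  define x where "x = real k / 2 + 1"
  have x: "x > 0" "Gamma x > 0" "Gamma (x + 1/2) > 0"
    by (auto simp: x_def intro!: Gamma_real_pos add_nonneg_pos)
  have "pi powr (real (Suc k) / 2) = pi powr (real k / 2) * sqrt pi"
    by (simp add: powr_half_sqrt[symmetric] powr_add[symmetric] add_divide_distrib add.commute)
  moreover have "real (Suc k) / 2 + 1 = x + 1/2"
    by (simp add: x_def field_simps)
  ultimately have S: "unit_ball_vol (real (Suc k)) = pi powr (real k / 2) * sqrt pi / Gamma (x + 1/2)"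
    by (simp only: unit_ball_vol_def)
  have "sqrt ((real k + 2) / (2 * pi)) * sqrt pi = sqrt x"
    by (simp add: real_sqrt_mult[symmetric] x_def field_simps)
  hence "sqrt ((real k + 2) / (2 * pi)) * unit_ball_vol (real (Suc k))
      = pi powr (real k / 2) * (sqrt x / Gamma (x + 1/2))"
    unfolding S by (simp add: field_simps)
  also have "\<dots> \<ge> pi powr (real k / 2) * (1 / Gamma x)"
    using Gamma_half_step[OF x(1)] x by (intro mult_left_mono) (auto simp: field_simps)
  finally show ?thesis
    by (simp add: unit_ball_vol_def x_def)
qed

text \<open>Iterates the single step. The last one goes from dimension \<open>k + e - 1\<close> to
  \<open>k + e\<close>, and since this is at most \<open>n\<close>, every factor is bounded by the
  one with \<open>n + 1\<close>.\<close>

lemma unit_ball_vol_ratio: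
  assumes "k + e \<le> n"
  shows "unit_ball_vol (real k) \<le> sqrt ((real n + 1) / (2 * pi)) ^ e * unit_ball_vol (real (k + e))"
  using assms
proof (induction e)
  case (Suc e)
  let ?s = "sqrt ((real n + 1) / (2 * pi))"
  have "unit_ball_vol (real k) \<le> ?s ^ e * unit_ball_vol (real (k + e))"
    using Suc by simp
  also have "unit_ball_vol (real (k + e))
      \<le> sqrt ((real (k + e) + 2) / (2 * pi)) * unit_ball_vol (real (Suc (k + e)))"
    by (rule unit_ball_vol_step)
  also have "\<dots> \<le> ?s * unit_ball_vol (real (Suc (k + e)))"
    using Suc.prems by (intro mult_right_mono) (auto intro!: divide_right_mono)
  finally show ?case by (simp add: mult_left_mono ac_simps)
qed simp

text \<open>After taking logarithms, the main term \<open>n / log 2 n * ln n\<close> of the power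
  equals \<open>n * ln 2\<close> and cancels against the right-hand side exactly. What decides is
  \<open>2 / pi < 1\<close>: this factor contributes a negative multiple of
  \<open>n / log 2 n\<close>, which beats the remaining logarithmic terms.\<close>

lemma eventually_volume_estimate:
  "eventually (\<lambda>n::nat. n \<ge> 3 \<and> nat \<lceil>real n / log 2 n\<rceil> < n \<and> 1 \<le> nat \<lceil>real n / log 2 n\<rceil>
     \<and> 8 * (real n)\<^sup>2 * (2 * (real n + 1) / pi) ^ nat \<lceil>real n / log 2 n\<rceil> < 2 ^ n) sequentially"
proof -
  have "eventually (\<lambda>n::nat. n \<ge> 3) sequentially" by (rule eventually_ge_at_top)
  moreover have "eventually (\<lambda>n::nat. real n / log 2 n + 1 < n) sequentially" by real_asymp
  moreover have "eventually (\<lambda>n::nat. real n / log 2 n > 0) sequentially" by real_asymp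
  \<comment> \<open>\<open>157/50\<close> is a rational lower bound of \<open>pi\<close>, and
    \<open>13/20\<close> lies strictly between \<open>2 / (157/50)\<close> and 1. The
    \<open>7/20\<close> in the next estimate is \<open>1 - 13/20\<close> and comes from
    \<open>ln x \<le> x - 1\<close>.\<close>
  moreover have "eventually (\<lambda>n::nat. 2 * (real n + 1) / (157/50) < (13/20) * n) sequentially" by real_asymp
  moreover have "eventually (\<lambda>n::nat. ln (8 * (real n)\<^sup>2) + ln n < (7/20) * (real n / log 2 n)) sequentially"
    by real_asymp
  ultimately show ?thesis
  proof eventually_elim
    case (elim n)
    define d where "d = nat \<lceil>real n / log 2 n\<rceil>"
    have d: "real d \<le> real n / log 2 n + 1" "real d > 0" using elim unfolding d_def by linarith+
    have n: "real n \<ge> 3" using elim by simp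
    have "2 * (real n + 1) / pi \<le> 2 * (real n + 1) / (157/50)"
      using pi_approx by (intro divide_left_mono) auto
    also note \<open>2 * (real n + 1) / (157/50) < (13/20) * n\<close>
    finally have "(2 * (real n + 1) / pi) ^ d \<le> ((13/20) * n) ^ d"
      by (intro power_mono) auto
    hence le: "8 * (real n)\<^sup>2 * (2 * (real n + 1) / pi) ^ d \<le> 8 * (real n)\<^sup>2 * ((13/20) * n) ^ d"
      by (intro mult_left_mono) auto
    have ln65: "ln ((13/20) :: real) \<le> -(7/20)" using ln_le_minus_one[of "(13/20) :: real"] by simp
    have "ln ((13/20) * n) = ln (13/20) + ln (real n)"
      using n by (intro ln_mult_pos) auto
    hence "(real n / log 2 n + 1) * ln ((13/20) * n) = real n / log 2 n * ln n
        + real n / log 2 n * ln (13/20) + ln (13/20) + ln n"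
      by (simp only:) (simp only: algebra_simps mult_1_left)
    also have "real n / log 2 n * ln n = n * ln 2" using n by (simp add: log_def)
    finally have e: "(real n / log 2 n + 1) * ln ((13/20) * n) = n * ln 2
        + real n / log 2 n * ln (13/20) + ln (13/20) + ln n" .
    have "real n / log 2 n * ln (13/20) \<le> real n / log 2 n * (-(7/20))"
      using ln65 n elim by (intro mult_left_mono) auto
    moreover define X where "X = real n / log 2 n"
    ultimately have key: "ln (8 * (real n)\<^sup>2) + (real n / log 2 n + 1) * ln ((13/20) * n) < n * ln 2"
      using e elim ln65 unfolding X_def[symmetric] by linarith
    have "8 * (real n)\<^sup>2 * ((13/20) * n) ^ d < 2 ^ n"
    proof (subst ln_less_cancel_iff[symmetric])
      have "ln (8 * (real n)\<^sup>2 * ((13/20) * n) ^ d) = ln (8 * (real n)\<^sup>2) + d * ln ((13/20) * n)"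
        using n by (subst ln_mult) (auto simp: ln_realpow)
      also have "d * ln ((13/20) * n) \<le> (real n / log 2 n + 1) * ln ((13/20) * n)"
        using d n by (intro mult_right_mono) auto
      finally show "ln (8 * (real n)\<^sup>2 * ((13/20) * n) ^ d) < ln (2 ^ n)"
        using key by (simp add: ln_realpow)
    qed (use n in auto)
    with le have "8 * (real n)\<^sup>2 * (2 * (real n + 1) / pi) ^ d < 2 ^ n" by linarith
    moreover have "d < n" "1 \<le> d" using d elim by auto
    ultimately show ?case using elim unfolding d_def by simp
  qed
qed

section \<open>Comparing the volumes of coverings and multiple packings\<close>

abbreviation (input) lborel_fun :: "nat set \<Rightarrow> (nat \<Rightarrow> real) measure" where
  "lborel_fun I \<equiv> Pi\<^sub>M I (\<lambda>_. lborel)"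

text \<open>Restricted to \<open>I\<close> so that the result is again a point of the product space,
  whose points are \<open>undefined\<close> off \<open>I\<close>.\<close>

definition shift :: "nat set \<Rightarrow> (nat \<Rightarrow> real) \<Rightarrow> (nat \<Rightarrow> real) \<Rightarrow> nat \<Rightarrow> real" where
  "shift I x y = (\<lambda>i\<in>I. y i + x i)"

lemma shift_measurable [measurable]: "shift I x \<in> measurable (lborel_fun I) (lborel_fun I)"
  unfolding shift_def by measurable

text \<open>A measure on a finite product is determined by its values on boxes, and there the claim
  reduces to translation invariance in one dimension.\<close>

lemma distr_shift:
  assumes "finite I"
  shows "distr (lborel_fun I) (lborel_fun I) (shift I x) = lborel_fun I"
proof -
  interpret product_sigma_finite "\<lambda>_::nat. lborel :: real measure"
    by standard
  show ?thesis
  proof (rule PiM_eqI[OF assms])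
    fix A :: "nat \<Rightarrow> real set" assume A: "\<And>i. i \<in> I \<Longrightarrow> A i \<in> sets lborel"
    have "shift I x -` Pi\<^sub>E I A \<inter> space (lborel_fun I) = Pi\<^sub>E I (\<lambda>i. (\<lambda>t. t + x i) -` A i)"
      by (auto simp: shift_def space_PiM PiE_def Pi_def extensional_def)
    moreover have "(\<lambda>t. t + x i) -` A i \<in> sets lborel" if "i \<in> I" for i
      using measurable_sets[of "\<lambda>t. t + x i" lborel lborel "A i"] A[OF that] by simp
    moreover have "emeasure lborel ((\<lambda>t. t + x i) -` A i) = emeasure lborel (A i)" if "i \<in> I" for i
    proof -
      have "emeasure lborel (A i) = emeasure (distr lborel borel ((+) (x i))) (A i)"
        by (simp add: lborel_distr_plus)
      also have "\<dots> = emeasure lborel ((\<lambda>t. t + x i) -` A i)"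
        using A[OF that] by (subst emeasure_distr) (auto simp: add.commute[of "x i"] vimage_def)
      finally show ?thesis by simp
    qed
    ultimately show "emeasure (distr (lborel_fun I) (lborel_fun I) (shift I x)) (Pi\<^sub>E I A)
        = (\<Prod>i\<in>I. emeasure lborel (A i))"
      using A assms by (subst emeasure_distr)
        (auto simp: emeasure_PiM intro!: sets_PiM_I_finite prod.cong)
  qed simp
qed

text \<open>Double counting. Integrate over \<open>C\<close> the number of \<open>x\<close> in
  \<open>G\<close> with \<open>y - x\<close> in \<open>A\<close>. By the covering this is at least
  the measure of \<open>C\<close>. Substituting \<open>y + x\<close> for \<open>y\<close> in each
  summand turns it into the integral over \<open>A\<close> of the number of \<open>x\<close> with
  \<open>y + x\<close> in \<open>C\<close>, which is at most \<open>N\<close>.\<close>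

lemma emeasure_le_multiplicity:
  fixes G :: "(nat \<Rightarrow> real) set"
  assumes I: "finite I" and G: "countable G" "infinite G"
    and [measurable]: "A \<in> sets (lborel_fun I)" "C \<in> sets (lborel_fun I)"
    and cover: "\<And>y. y \<in> space (lborel_fun I) \<Longrightarrow> \<exists>x\<in>G. shift I (\<lambda>i. - x i) y \<in> A"
    and mult: "\<And>y. y \<in> space (lborel_fun I) \<Longrightarrow>
      finite {x\<in>G. shift I x y \<in> C} \<and> card {x\<in>G. shift I x y \<in> C} \<le> N"
  shows "emeasure (lborel_fun I) C \<le> of_nat N * emeasure (lborel_fun I) A"
proof -
  let ?M = "lborel_fun I"
  define g where "g = from_nat_into G"
  have g: "bij_betw g UNIV G"
    unfolding g_def using bij_betw_from_nat_into[OF G] .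
  have shift_inverse: "shift I (\<lambda>i. - x i) (shift I x y) = y" if "y \<in> space ?M" for x y
    using that by (auto simp: shift_def space_PiM PiE_def extensional_def)
  have "emeasure ?M C = (\<integral>\<^sup>+y. indicator C y \<partial>?M)" by simp
  also have "\<dots> \<le> (\<integral>\<^sup>+y. (\<Sum>k. indicator C y * indicator A (shift I (\<lambda>i. - g k i) y)) \<partial>?M)"
  proof (rule nn_integral_mono)
    fix y assume "y \<in> space ?M"
    from cover[OF this] obtain k where k: "shift I (\<lambda>i. - g k i) y \<in> A"
      using g by (auto simp: bij_betw_def)
    have "indicator C y = (\<Sum>k\<in>{k}. indicator C y * indicator A (shift I (\<lambda>i. - g k i) y) :: ennreal)"
      using k by simp
    also have "\<dots> \<le> (\<Sum>k. indicator C y * indicator A (shift I (\<lambda>i. - g k i) y))"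
      by (rule sum_le_suminf) auto
    finally show "indicator C y \<le> (\<Sum>k. indicator C y * indicator A (shift I (\<lambda>i. - g k i) y) :: ennreal)" .
  qed
  also have "\<dots> = (\<Sum>k. \<integral>\<^sup>+y. indicator C y * indicator A (shift I (\<lambda>i. - g k i) y) \<partial>?M)"
    by (rule nn_integral_suminf) measurable
  also have "\<dots> = (\<Sum>k. \<integral>\<^sup>+y. indicator C (shift I (g k) y) * indicator A y \<partial>?M)"
  proof (rule suminf_cong)
    fix k
    have "(\<integral>\<^sup>+y. indicator C y * indicator A (shift I (\<lambda>i. - g k i) y) \<partial>?M)
        = (\<integral>\<^sup>+y. indicator C y * indicator A (shift I (\<lambda>i. - g k i) y) \<partial>distr ?M ?M (shift I (g k)))"
      by (simp add: distr_shift[OF I])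
    also have "\<dots> = (\<integral>\<^sup>+y. indicator C (shift I (g k) y)
        * indicator A (shift I (\<lambda>i. - g k i) (shift I (g k) y)) \<partial>?M)"
      by (rule nn_integral_distr) measurable
    also have "\<dots> = (\<integral>\<^sup>+y. indicator C (shift I (g k) y) * indicator A y \<partial>?M)"
      by (rule nn_integral_cong) (simp add: shift_inverse)
    finally show "(\<integral>\<^sup>+y. indicator C y * indicator A (shift I (\<lambda>i. - g k i) y) \<partial>?M)
        = (\<integral>\<^sup>+y. indicator C (shift I (g k) y) * indicator A y \<partial>?M)" .
  qed
  also have "\<dots> = (\<integral>\<^sup>+y. (\<Sum>k. indicator C (shift I (g k) y) * indicator A y) \<partial>?M)"
    by (rule nn_integral_suminf[symmetric]) measurable
  also have "\<dots> \<le> (\<integral>\<^sup>+y. of_nat N * indicator A y \<partial>?M)"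
  proof (rule nn_integral_mono)
    fix y assume y: "y \<in> space ?M"
    define S where "S = {k. shift I (g k) y \<in> C}"
    have "bij_betw g S {x\<in>G. shift I x y \<in> C}"
      using g by (auto simp: S_def bij_betw_def inj_on_def)
    hence S: "finite S" "card S \<le> N"
      using mult[OF y] bij_betw_finite[of g S] bij_betw_same_card[of g S] by auto
    have "(\<Sum>k. indicator C (shift I (g k) y) * indicator A y :: ennreal)
        = (\<Sum>k\<in>S. indicator C (shift I (g k) y) * indicator A y)"
      by (rule suminf_finite[OF S(1)]) (auto simp: S_def)
    also have "\<dots> = of_nat (card S) * indicator A y"
      by (simp add: S_def)
    also have "\<dots> \<le> of_nat N * indicator A y"
      using S(2) by (intro mult_right_mono) auto
    finally show "(\<Sum>k. indicator C (shift I (g k) y) * indicator A y :: ennreal)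
      \<le> of_nat N * indicator A y" .
  qed
  also have "\<dots> = of_nat N * emeasure ?M A"
    by (simp add: nn_integral_cmult_indicator)
  finally show ?thesis .
qed

text \<open>Both bodies of the volume comparison have this form, one split at \<open>d\<close> and
  one at a smaller index. The half-open sides fit \<open>frame_reduce\<close>, and coordinates of
  two points in the box differ by strictly less than \<open>l j\<close>, as
  \<open>frame_unique\<close> requires.\<close>

definition box_ball :: "nat \<Rightarrow> nat \<Rightarrow> (nat \<Rightarrow> real) \<Rightarrow> real \<Rightarrow> (nat \<Rightarrow> real) set" where
  "box_ball n i l R = {y \<in> space (lborel_fun {..<n}).
     (\<forall>j<i. 0 \<le> y j \<and> y j < l j) \<and> (\<Sum>k=i..<n. (y k)\<^sup>2) \<le> R\<^sup>2}"

lemma box_ball_measurable: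
  assumes "i \<le> n"
  shows "box_ball n i l R \<in> sets (lborel_fun {..<n})"
proof -
  have [measurable]: "(\<lambda>y. y j) \<in> borel_measurable (lborel_fun {..<n})" if "j < n" for j
    using measurable_component_singleton[of j "{..<n}" "\<lambda>_. lborel :: real measure"] that by simp
  have "{y \<in> space (lborel_fun {..<n}). \<forall>j\<in>{..<i}. 0 \<le> y j \<and> y j < l j} \<in> sets (lborel_fun {..<n})"
    using assms by (intro sets.sets_Collect_finite_All) (auto intro!: borel_measurable_le borel_measurable_less)
  moreover have "{y \<in> space (lborel_fun {..<n}). (\<Sum>k=i..<n. (y k)\<^sup>2) \<le> R\<^sup>2} \<in> sets (lborel_fun {..<n})"
    by (intro borel_measurable_le borel_measurable_sum borel_measurable_power) auto
  ultimately have "{y \<in> space (lborel_fun {..<n}). \<forall>j\<in>{..<i}. 0 \<le> y j \<and> y j < l j} \<inter>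
    {y \<in> space (lborel_fun {..<n}). (\<Sum>k=i..<n. (y k)\<^sup>2) \<le> R\<^sup>2} \<in> sets (lborel_fun {..<n})"
    by (rule sets.Int)
  also have "{y \<in> space (lborel_fun {..<n}). \<forall>j\<in>{..<i}. 0 \<le> y j \<and> y j < l j} \<inter>
    {y \<in> space (lborel_fun {..<n}). (\<Sum>k=i..<n. (y k)\<^sup>2) \<le> R\<^sup>2} = box_ball n i l R"
    by (auto simp: box_ball_def)
  finally show ?thesis .
qed

text \<open>\<open>merge\<close> identifies the body with the product of a box in the first
  \<open>i\<close> coordinates and a ball in the others, so the measure factors.\<close>

lemma emeasure_box_ball:
  assumes i: "i \<le> n" and R: "R > 0" and l: "\<And>j. j < i \<Longrightarrow> l j \<ge> 0"
  shows "emeasure (lborel_fun {..<n}) (box_ball n i l R)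
    = ennreal (unit_ball_vol (real (n - i)) * R ^ (n - i) * (\<Prod>j<i. l j))"
proof -
  interpret product_sigma_finite "\<lambda>_::nat. lborel :: real measure"
    by standard
  let ?I = "{..<i}" and ?J = "{i..<n}"
  let ?B = "Pi\<^sub>E ?I (\<lambda>j. {0..<l j})"
  let ?D = "{f. sqrt (\<Sum>k\<in>?J. (f k)\<^sup>2) \<le> R} \<inter> space (lborel_fun ?J)"
  have IJ: "?I \<inter> ?J = {}" "?I \<union> ?J = {..<n}" using i by auto
  interpret J: finite_product_sigma_finite "\<lambda>_::nat. lborel :: real measure" ?J by standard auto
  have D[measurable]: "?D \<in> sets (lborel_fun ?J)"
    by measurable
  have B[measurable]: "?B \<in> sets (lborel_fun ?I)"
    by (intro sets_PiM_I_finite) auto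
  have "emeasure (lborel_fun {..<n}) (box_ball n i l R)
    = emeasure (distr (lborel_fun ?I \<Otimes>\<^sub>M lborel_fun ?J) (lborel_fun (?I \<union> ?J)) (merge ?I ?J)) (box_ball n i l R)"
    using distr_merge[of ?I ?J] IJ by simp
  also have "\<dots> = emeasure (lborel_fun ?I \<Otimes>\<^sub>M lborel_fun ?J)
      (merge ?I ?J -` box_ball n i l R \<inter> space (lborel_fun ?I \<Otimes>\<^sub>M lborel_fun ?J))"
    using box_ball_measurable[OF i] IJ(2) measurable_merge[of ?I ?J "\<lambda>_. lborel :: real measure"]
    by (subst emeasure_distr) auto
  also have "merge ?I ?J -` box_ball n i l R \<inter> space (lborel_fun ?I \<Otimes>\<^sub>M lborel_fun ?J) = ?B \<times> ?D"
  proof (rule Set.set_eqI)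
    fix z :: "(nat \<Rightarrow> real) \<times> (nat \<Rightarrow> real)"
    obtain u v where z: "z = (u, v)" by (cases z)
    have "(\<Sum>k=i..<n. (merge ?I ?J (u, v) k)\<^sup>2) = (\<Sum>k=i..<n. (v k)\<^sup>2)"
      by (intro sum.cong) (auto simp: merge_def)
    moreover have "(\<forall>j<i. 0 \<le> merge ?I ?J (u, v) j \<and> merge ?I ?J (u, v) j < l j)
      \<longleftrightarrow> (\<forall>j<i. 0 \<le> u j \<and> u j < l j)"
      by (auto simp: merge_def)
    moreover have "merge ?I ?J (u, v) \<in> space (lborel_fun {..<n})"
      using extensional_merge[of ?I ?J u v] IJ by (auto simp: space_PiM PiE_def)
    moreover have "sqrt (\<Sum>k=i..<n. (v k)\<^sup>2) \<le> R \<longleftrightarrow> (\<Sum>k=i..<n. (v k)\<^sup>2) \<le> R\<^sup>2"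
      using R by (intro real_sqrt_le_iff') (auto intro!: sum_nonneg)
    ultimately show "z \<in> merge ?I ?J -` box_ball n i l R \<inter> space (lborel_fun ?I \<Otimes>\<^sub>M lborel_fun ?J)
      \<longleftrightarrow> z \<in> ?B \<times> ?D"
      unfolding z by (auto simp: box_ball_def space_pair_measure space_PiM PiE_def Pi_def)
  qed
  also have "emeasure (lborel_fun ?I \<Otimes>\<^sub>M lborel_fun ?J) (?B \<times> ?D)
      = emeasure (lborel_fun ?I) ?B * emeasure (lborel_fun ?J) ?D"
    by (rule J.emeasure_pair_measure_Times[OF B D])
  also have "emeasure (lborel_fun ?I) ?B = ennreal (\<Prod>j<i. l j)"
    using l by (subst emeasure_PiM) (auto intro!: prod_ennreal)
  also have "emeasure (lborel_fun ?J) ?D = ennreal (unit_ball_vol (real (n - i)) * R ^ (n - i))"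
    using emeasure_cball_aux[of ?J R] R by simp
  also have "ennreal (\<Prod>j<i. l j) * ennreal (unit_ball_vol (real (n - i)) * R ^ (n - i))
    = ennreal (unit_ball_vol (real (n - i)) * R ^ (n - i) * (\<Prod>j<i. l j))"
    using l R by (subst ennreal_mult''[symmetric]) (auto simp: mult.commute intro!: prod_nonneg)
  finally show ?thesis .
qed

section \<open>Reduced frames and reflections\<close>

text \<open>The squared length of \<open>\<pi>\<^sub>i x\<close>; for \<open>i = 0\<close>, the
  squared Euclidean norm.\<close>

definition tail_sq :: "nat \<Rightarrow> nat \<Rightarrow> (nat \<Rightarrow> real) \<Rightarrow> real" where
  "tail_sq n i x = (\<Sum>k=i..<n. (x k)\<^sup>2)"

text \<open>
  From here on, points of \<open>n\<close>-space are functions of which only the first \<open>n\<close> values matter, indexed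
  from \<open>0\<close>. The plane below is \<open>p + span {w 0, \<dots>, w (d - 1)}\<close>.
\<close>

definition free_plane :: "nat \<Rightarrow> nat \<Rightarrow> real \<Rightarrow> (nat \<Rightarrow> real) set \<Rightarrow> bool" where
  "free_plane n d r G \<longleftrightarrow> (\<exists>p w.
     (\<forall>t. (\<forall>k<n. (\<Sum>j<d. t j * w j k) = 0) \<longrightarrow> (\<forall>j<d. t j = 0)) \<and>
     (\<forall>t. \<forall>x\<in>G. r\<^sup>2 \<le> tail_sq n 0 (\<lambda>k. p k + (\<Sum>j<d. t j * w j k) - x k)))"

lemma tail_sq_nonneg [simp]: "0 \<le> tail_sq n i x"
  by (simp add: tail_sq_def sum_nonneg)

lemma tail_sq_mono: "i \<le> j \<Longrightarrow> tail_sq n j x \<le> tail_sq n i x"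
  unfolding tail_sq_def by (intro sum_mono2) auto

lemma tail_sq_eq_0_iff: "tail_sq n i x = 0 \<longleftrightarrow> (\<forall>k. i \<le> k \<longrightarrow> k < n \<longrightarrow> x k = 0)"
  by (auto simp: tail_sq_def sum_nonneg_eq_0_iff)

lemma tail_sq_cong:
  "(\<And>k. i \<le> k \<Longrightarrow> k < n \<Longrightarrow> (x k)\<^sup>2 = (y k)\<^sup>2) \<Longrightarrow> tail_sq n i x = tail_sq n i y"
  by (auto simp: tail_sq_def intro!: sum.cong)

lemma tail_sq_single:
  assumes "i < n" "\<And>k. i < k \<Longrightarrow> k < n \<Longrightarrow> x k = 0"
  shows "tail_sq n i x = (x i)\<^sup>2"
proof -
  have "tail_sq n i x = (x i)\<^sup>2 + (\<Sum>k=Suc i..<n. (x k)\<^sup>2)"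
    unfolding tail_sq_def using assms(1) by (rule sum.atLeast_Suc_lessThan)
  also have "(\<Sum>k=Suc i..<n. (x k)\<^sup>2) = 0"
    using assms(2) by (intro sum.neutral) auto
  finally show ?thesis by simp
qed

lemma abs_le_sqrt_tail_sq:
  assumes "i \<le> k" "k < n"
  shows "\<bar>x k\<bar> \<le> sqrt (tail_sq n i x)"
proof -
  have "(x k)\<^sup>2 \<le> tail_sq n i x"
    unfolding tail_sq_def using assms by (intro member_le_sum) auto
  thus ?thesis using real_sqrt_le_mono by fastforce
qed

text \<open>The lattice enters only through properties that reflections preserve, without a basis:
  an additive group, distinct points at distance at least \<open>2 * r\<close>, and spanning in dual
  form, as no nonzero linear functional vanishes on it. By \<open>supp\<close>, equality of
  functions is equality of the first \<open>n\<close> coordinates.\<close>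

locale packing_group =
  fixes n :: nat and r :: real and G :: "(nat \<Rightarrow> real) set"
  assumes r_pos: "r > 0"
    and zero_mem: "(\<lambda>_. 0) \<in> G"
    and diff_mem: "x \<in> G \<Longrightarrow> y \<in> G \<Longrightarrow> (\<lambda>k. x k - y k) \<in> G"
    and supp: "x \<in> G \<Longrightarrow> n \<le> k \<Longrightarrow> x k = 0"
    and separated: "x \<in> G \<Longrightarrow> x \<noteq> (\<lambda>_. 0) \<Longrightarrow> (2 * r)\<^sup>2 \<le> tail_sq n 0 x"
    and nondegenerate: "\<exists>k<n. a k \<noteq> 0 \<Longrightarrow> \<exists>x\<in>G. (\<Sum>k<n. a k * x k) \<noteq> 0"
begin

lemma uminus_mem: "x \<in> G \<Longrightarrow> (\<lambda>k. - x k) \<in> G"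
  using diff_mem[OF zero_mem, of x] by simp

lemma add_mem: "x \<in> G \<Longrightarrow> y \<in> G \<Longrightarrow> (\<lambda>k. x k + y k) \<in> G"
  using diff_mem[of x, OF _ uminus_mem, of y] by simp

lemma of_nat_mult_mem: "x \<in> G \<Longrightarrow> (\<lambda>k. real m * x k) \<in> G"
proof (induction m)
  case (Suc m)
  from add_mem[OF Suc.prems Suc.IH[OF Suc.prems]] show ?case by (simp add: algebra_simps)
qed (simp add: zero_mem)

lemma of_int_mult_mem:
  assumes "x \<in> G"
  shows "(\<lambda>k. of_int m * x k) \<in> G"
proof (cases "m \<ge> 0")
  case True
  thus ?thesis using of_nat_mult_mem[OF assms, of "nat m"] by simp
next
  case False
  thus ?thesis using uminus_mem[OF of_nat_mult_mem[OF assms, of "nat (-m)"]] by simp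
qed

text \<open>Pigeonhole on a grid of mesh \<open>1 / s\<close>, so fine that the cells have diameter
  below \<open>2 * r\<close>: a cell holds at most one point, and a bounded region meets finitely
  many cells.\<close>

lemma finite_bounded: "finite {x\<in>G. \<forall>k<n. \<bar>x k\<bar> \<le> M}"
proof -
  obtain s :: nat where s: "s > 0" "real n / (real s)\<^sup>2 < (2 * r)\<^sup>2"
  proof -
    have "(\<lambda>s. real n / (real s)\<^sup>2) \<longlonglongrightarrow> 0"
      by (intro tendsto_divide_0[OF tendsto_const] filterlim_at_top_imp_at_infinity
          filterlim_pow_at_top filterlim_real_sequentially) auto
    hence "eventually (\<lambda>s. real n / (real s)\<^sup>2 < (2 * r)\<^sup>2) sequentially"
      using r_pos by (intro order_tendstoD(2)) auto
    hence "eventually (\<lambda>s. s > 0 \<and> real n / (real s)\<^sup>2 < (2 * r)\<^sup>2) sequentially"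
      using eventually_gt_at_top[of "0::nat"] by eventually_elim auto
    thus ?thesis using that by (auto dest: eventually_happens)
  qed
  define f :: "(nat \<Rightarrow> real) \<Rightarrow> nat \<Rightarrow> int" where "f x = (\<lambda>k\<in>{..<n}. \<lfloor>real s * x k\<rfloor>)" for x
  let ?S = "{x\<in>G. \<forall>k<n. \<bar>x k\<bar> \<le> M}"
  have "inj_on f ?S"
  proof (rule inj_onI, rule ccontr)
    fix x y assume x: "x \<in> ?S" and y: "y \<in> ?S" and fxy: "f x = f y" and ne: "x \<noteq> y"
    have close: "(x k - y k)\<^sup>2 \<le> (1 / real s)\<^sup>2" if "k < n" for k
    proof (rule abs_le_square_iff[THEN iffD1])
      have "\<lfloor>real s * x k\<rfloor> = \<lfloor>real s * y k\<rfloor>" using fun_cong[OF fxy, of k] that by (simp add: f_def)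
      hence "\<bar>s * x k - s * y k\<bar> \<le> 1" by linarith
      hence "\<bar>real s * (x k - y k)\<bar> \<le> 1" by (simp only: right_diff_distrib)
      hence "real s * \<bar>x k - y k\<bar> \<le> 1" by (simp add: abs_mult)
      thus "\<bar>x k - y k\<bar> \<le> \<bar>1 / real s\<bar>"
        using s(1) by (simp add: pos_le_divide_eq mult.commute)
    qed
    have "tail_sq n 0 (\<lambda>k. x k - y k) \<le> (\<Sum>k=0..<n. (1 / real s)\<^sup>2)"
      unfolding tail_sq_def using close by (intro sum_mono) auto
    also have "\<dots> < (2 * r)\<^sup>2" using s by (simp add: power_divide)
    finally have "\<not> (2 * r)\<^sup>2 \<le> tail_sq n 0 (\<lambda>k. x k - y k)" by simp
    moreover have "(\<lambda>k. x k - y k) \<noteq> (\<lambda>_. 0)" using ne by (auto simp: fun_eq_iff)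
    ultimately show False using separated[OF diff_mem[of x y]] x y by auto
  qed
  moreover have "f ` ?S \<subseteq> PiE {..<n} (\<lambda>_. {\<lfloor>- (real s * M)\<rfloor>..\<lfloor>real s * M\<rfloor>})"
  proof (intro image_subsetI)
    fix x assume "x \<in> ?S"
    moreover have "\<lfloor>- (real s * M)\<rfloor> \<le> \<lfloor>real s * x k\<rfloor> \<and> \<lfloor>real s * x k\<rfloor> \<le> \<lfloor>real s * M\<rfloor>" if "\<bar>x k\<bar> \<le> M" for k
    proof -
      have "s * x k \<le> s * M" "s * (- M) \<le> s * x k"
        using that by (intro mult_left_mono; auto simp: abs_le_iff)+
      thus ?thesis by (auto intro!: floor_mono)
    qed
    ultimately show "f x \<in> PiE {..<n} (\<lambda>_. {\<lfloor>- (real s * M)\<rfloor>..\<lfloor>real s * M\<rfloor>})"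
      by (auto simp: f_def)
  qed
  ultimately show ?thesis
    by (rule inj_on_finite) (auto intro!: finite_PiE)
qed

lemma countable_G: "countable G"
proof -
  have "G \<subseteq> (\<Union>M::nat. {x\<in>G. \<forall>k<n. \<bar>x k\<bar> \<le> real M})"
  proof
    fix x assume "x \<in> G"
    obtain M :: nat where M: "(\<Sum>k<n. \<bar>x k\<bar>) \<le> real M" using real_arch_simple by blast
    have "\<bar>x k\<bar> \<le> real M" if "k < n" for k
      using that by (intro order_trans[OF _ M] member_le_sum) auto
    with \<open>x \<in> G\<close> show "x \<in> (\<Union>M::nat. {x\<in>G. \<forall>k<n. \<bar>x k\<bar> \<le> real M})" by auto
  qed
  moreover have "countable (\<Union>M::nat. {x\<in>G. \<forall>k<n. \<bar>x k\<bar> \<le> real M})"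
    using finite_bounded by (intro countable_UN) (auto intro: countable_finite)
  ultimately show ?thesis by (rule countable_subset)
qed

lemma infinite_G:
  assumes "x \<in> G" "x \<noteq> (\<lambda>_. 0)"
  shows "infinite G"
proof
  assume "finite G"
  obtain k where k: "x k \<noteq> 0" using assms(2) by (auto simp: fun_eq_iff)
  have "inj (\<lambda>m::nat. (\<lambda>k. real m * x k))"
  proof (rule injI)
    fix m m' :: nat assume "(\<lambda>k. real m * x k) = (\<lambda>k. real m' * x k)"
    from fun_cong[OF this, of k] show "m = m'" using k by simp
  qed
  moreover have "range (\<lambda>m::nat. (\<lambda>k. real m * x k)) \<subseteq> G"
    using of_nat_mult_mem[OF assms(1)] by auto
  ultimately show False
    using \<open>finite G\<close> finite_subset range_inj_infinite by blast
qed

text \<open>The start of a Hermite-Korkin-Zolotarev basis in coordinates adapted to it: triangular,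
  with \<open>b j j\<close> the length of a shortest nonzero vector of
  \<open>\<pi>\<^sub>j G\<close>. The condition \<open>tail_sq n j x > 0\<close> says that the
  projection of \<open>x\<close> is nonzero.\<close>

definition frame :: "nat \<Rightarrow> (nat \<Rightarrow> nat \<Rightarrow> real) \<Rightarrow> bool" where
  "frame i b \<longleftrightarrow> (\<forall>j<i. b j \<in> G \<and> b j j > 0 \<and> (\<forall>k>j. b j k = 0) \<and>
     (\<forall>x\<in>G. tail_sq n j x > 0 \<longrightarrow> (b j j)\<^sup>2 \<le> tail_sq n j x))"

text \<open>Floor rounding from the highest index down: a multiple of \<open>b i\<close> places
  coordinate \<open>i\<close>, and the later corrections by \<open>b j\<close> with
  \<open>j < i\<close> leave it alone because these vectors vanish from index \<open>i\<close>
  on.\<close>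

lemma frame_reduce:
  assumes "frame i b" "x \<in> G"
  shows "\<exists>y\<in>G. (\<forall>k\<ge>i. y k = x k) \<and> (\<forall>j<i. a j \<le> y j \<and> y j < a j + b j j)"
  using assms
proof (induction i arbitrary: x)
  case (Suc i)
  hence i: "frame i b" "b i \<in> G" "b i i > 0" "\<forall>k>i. b i k = 0"
    by (auto simp: frame_def)
  define m where "m = \<lfloor>(x i - a i) / b i i\<rfloor>"
  define z where "z = (\<lambda>k. x k - of_int m * b i k)"
  have "z \<in> G" unfolding z_def by (intro diff_mem of_int_mult_mem i Suc.prems)
  with Suc.IH[OF i(1)] obtain y where y: "y \<in> G" "\<forall>k\<ge>i. y k = z k"
    "\<forall>j<i. a j \<le> y j \<and> y j < a j + b j j" by blast
  have "real_of_int m \<le> (x i - a i) / b i i" "(x i - a i) / b i i < real_of_int m + 1"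
    unfolding m_def by linarith+
  hence "a i \<le> z i" "z i < a i + b i i"
    using i(3) by (simp_all add: z_def field_simps)
  with y i(4) show ?case
    by (intro bexI[of _ y]) (auto simp: less_Suc_eq z_def)
qed auto

text \<open>Let \<open>j\<close> be the last nonzero coordinate of the difference \<open>z\<close>.
  The vanishing tail forces \<open>j < i\<close>, and then \<open>\<pi>\<^sub>j z\<close> is
  \<open>z j\<close> times a unit vector, nonzero and yet shorter than \<open>b j j\<close>.\<close>

lemma frame_unique:
  assumes "frame i b" "x \<in> G" "y \<in> G"
    and tail: "tail_sq n i (\<lambda>k. x k - y k) = 0"
    and close: "\<And>j. j < i \<Longrightarrow> \<bar>x j - y j\<bar> < b j j"
  shows "x = y"
proof (rule ccontr)
  assume "x \<noteq> y"
  define z where "z = (\<lambda>k. x k - y k)"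
  have z: "z \<in> G" unfolding z_def by (intro diff_mem assms)
  define K where "K = {k. k < n \<and> z k \<noteq> 0}"
  have "K \<noteq> {}"
  proof
    assume "K = {}"
    hence "z k = 0" for k using supp[OF z] by (cases "k < n") (auto simp: K_def)
    with \<open>x \<noteq> y\<close> show False by (auto simp: z_def fun_eq_iff)
  qed
  moreover have "finite K" by (auto simp: K_def)
  ultimately have m: "Max K \<in> K" "\<And>k. k \<in> K \<Longrightarrow> k \<le> Max K" by auto
  define j where "j = Max K"
  have j: "j < n" "z j \<noteq> 0" using m(1) by (auto simp: j_def K_def)
  have "j < i" using tail j by (force simp: tail_sq_eq_0_iff z_def not_le)
  have "z k = 0" if "j < k" "k < n" for k
  proof -
    have "k \<notin> K" using m(2)[of k] that by (auto simp flip: j_def)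
    with that show ?thesis by (simp add: K_def)
  qed
  hence "tail_sq n j z = (z j)\<^sup>2"
    using j by (intro tail_sq_single)
  moreover from this have "0 < tail_sq n j z" using j by simp
  hence "(b j j)\<^sup>2 \<le> tail_sq n j z"
    using assms(1) \<open>j < i\<close> z unfolding frame_def by blast
  ultimately have "\<bar>b j j\<bar> \<le> \<bar>z j\<bar>" by (simp add: abs_le_square_iff)
  with close[OF \<open>j < i\<close>] show False by (simp add: z_def)
qed

text \<open>Reduction by the frame gives every projected vector a preimage whose first
  \<open>i\<close> coordinates are bounded. The reduced preimages of projections no longer than a
  fixed nonzero one form a bounded, hence finite, set, and a minimum exists.\<close>

lemma frame_shortest:
  assumes "frame i b" "i < n"
  shows "\<exists>x\<in>G. tail_sq n i x > 0 \<and>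
    (\<forall>y\<in>G. tail_sq n i y > 0 \<longrightarrow> tail_sq n i x \<le> tail_sq n i y)"
proof -
  \<comment> \<open>The coordinate functional at \<open>i\<close> does not vanish on
    \<open>G\<close>, which supplies a vector with nonzero projection.\<close>
  have "\<exists>x\<in>G. (\<Sum>k<n. (if k = i then 1 else 0) * x k) \<noteq> 0"
    using assms(2) by (intro nondegenerate) auto
  then obtain x0 where x0: "x0 \<in> G" "x0 i \<noteq> 0"
    using assms(2) by (auto simp: if_distrib[of "\<lambda>c. c * _"] cong: if_cong)
  have x0_pos: "tail_sq n i x0 > 0"
    using x0(2) assms(2) tail_sq_nonneg[of n i x0] tail_sq_eq_0_iff[of n i x0]
    by (auto simp: less_le)
  define S where "S = {x\<in>G. tail_sq n i x > 0 \<and> tail_sq n i x \<le> tail_sq n i x0 \<and>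
    (\<forall>j<i. 0 \<le> x j \<and> x j < 0 + b j j)}"
  have red: "\<exists>x\<in>S. tail_sq n i x = tail_sq n i y"
    if "y \<in> G" "tail_sq n i y > 0" "tail_sq n i y \<le> tail_sq n i x0" for y
  proof -
    from frame_reduce[OF assms(1) that(1), of "\<lambda>_. 0"] obtain x where
      x: "x \<in> G" "\<forall>k\<ge>i. x k = y k" "\<forall>j<i. 0 \<le> x j \<and> x j < 0 + b j j" by blast
    moreover from this have "tail_sq n i x = tail_sq n i y" by (intro tail_sq_cong) auto
    ultimately show ?thesis using that by (auto simp: S_def)
  qed
  define M where "M = (\<Sum>j<i. b j j) + sqrt (tail_sq n i x0)"
  have b: "b j j > 0" if "j < i" for j using assms(1) that by (auto simp: frame_def)
  have "S \<subseteq> {x\<in>G. \<forall>k<n. \<bar>x k\<bar> \<le> M}"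
  proof (intro subsetI CollectI conjI allI impI)
    fix x k assume x: "x \<in> S" and k: "k < n"
    show "\<bar>x k\<bar> \<le> M"
    proof (cases "k < i")
      case True
      have "b k k \<le> (\<Sum>j<i. b j j)" using True b by (intro member_le_sum) (auto simp: less_imp_le)
      with x True show ?thesis by (force simp: S_def M_def intro!: add_increasing2)
    next
      case False
      have "\<bar>x k\<bar> \<le> sqrt (tail_sq n i x)" using False k by (intro abs_le_sqrt_tail_sq) auto
      also have "\<dots> \<le> sqrt (tail_sq n i x0)" using x by (auto simp: S_def)
      also have "\<dots> \<le> M" using b sum_nonneg[of "{..<i}" "\<lambda>j. b j j"] by (auto simp: M_def less_imp_le)
      finally show ?thesis .
    qed
  qed (auto simp: S_def)
  hence fin: "finite S" using finite_bounded finite_subset by blast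
  moreover have "S \<noteq> {}" using red[OF x0(1) x0_pos] by auto
  ultimately obtain x where x: "x \<in> S" "\<And>y. y \<in> S \<Longrightarrow> tail_sq n i x \<le> tail_sq n i y"
    using arg_min_if_finite[of S "tail_sq n i"] by (metis not_le)
  show ?thesis
  proof (intro bexI[of _ x] conjI ballI impI)
    show "x \<in> G" "tail_sq n i x > 0" using x(1) by (auto simp: S_def)
    fix y assume y: "y \<in> G" "tail_sq n i y > 0"
    show "tail_sq n i x \<le> tail_sq n i y"
    proof (cases "tail_sq n i y \<le> tail_sq n i x0")
      case True
      from red[OF y True] x(2) show ?thesis by force
    qed (use x(1) in \<open>auto simp: S_def\<close>)
  qed
qed

end

section \<open>Householder reflections\<close>

definition ip :: "nat \<Rightarrow> (nat \<Rightarrow> real) \<Rightarrow> (nat \<Rightarrow> real) \<Rightarrow> real" where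
  "ip n x y = (\<Sum>k<n. x k * y k)"

text \<open>The reflection in the hyperplane orthogonal to \<open>v\<close>. Reflections suffice for
  all changes of coordinates below, and each is its own inverse.\<close>

definition reflect :: "nat \<Rightarrow> (nat \<Rightarrow> real) \<Rightarrow> (nat \<Rightarrow> real) \<Rightarrow> nat \<Rightarrow> real" where
  "reflect n v x = (\<lambda>k. x k - 2 * ip n v x / ip n v v * v k)"

lemma ip_self_eq_0: "ip n v v = 0 \<Longrightarrow> k < n \<Longrightarrow> v k = 0"
  by (simp add: ip_def sum_nonneg_eq_0_iff)

lemma ip_linear:
  "ip n v (\<lambda>k. x k - y k) = ip n v x - ip n v y"
  "ip n v (\<lambda>k. x k + y k) = ip n v x + ip n v y"
  "ip n v (\<lambda>k. c * x k) = c * ip n v x"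
  "ip n v (\<lambda>k. \<Sum>j\<in>J. f j k) = (\<Sum>j\<in>J. ip n v (f j))"
  by (simp_all add: ip_def algebra_simps sum.distrib sum_subtractf sum_distrib_left)
     (subst sum.swap, rule refl)

lemma reflect_apply: "reflect n v x k = x k - (2 * v k / ip n v v) * ip n v x"
  by (simp add: reflect_def)

lemma reflect_diff: "reflect n v (\<lambda>k. x k - y k) = (\<lambda>k. reflect n v x k - reflect n v y k)"
  unfolding reflect_apply fun_eq_iff ip_linear(1) by (simp only: right_diff_distrib) simp

lemma reflect_add: "reflect n v (\<lambda>k. x k + y k) = (\<lambda>k. reflect n v x k + reflect n v y k)"
  unfolding reflect_apply fun_eq_iff ip_linear(2) by (simp only: distrib_left) simp

lemma reflect_sum:
  "reflect n v (\<lambda>k. \<Sum>j\<in>J. t j * w j k) = (\<lambda>k. \<Sum>j\<in>J. t j * reflect n v (w j) k)"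
  unfolding reflect_apply fun_eq_iff ip_linear(4) ip_linear(3)
  by (simp only: right_diff_distrib sum_subtractf sum_distrib_left mult.left_commute) simp

lemma ip_reflect_right: "ip n v (reflect n v x) = - ip n v x"
  if "ip n v v \<noteq> 0"
proof -
  have "ip n v (reflect n v x) = ip n v x - 2 * ip n v x / ip n v v * ip n v v"
    unfolding reflect_def ip_linear(1,3) ..
  with that show ?thesis by simp
qed

lemma reflect_reflect: "reflect n v (reflect n v x) = x"
proof (cases "ip n v v = 0")
  case False
  thus ?thesis by (simp add: reflect_def[of n v "reflect n v x"] ip_reflect_right)
    (simp add: reflect_def)
qed (simp add: reflect_def)

lemma ip_commute: "ip n x y = ip n y x"
  by (simp add: ip_def mult.commute)

lemma reflect_self_adjoint: "ip n x (reflect n v y) = ip n (reflect n v x) y"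
proof -
  have reflect: "ip n x (reflect n v y) = ip n x y - 2 * ip n v y / ip n v v * ip n x v" for x y
    unfolding reflect_def ip_linear(1,3) ..
  show ?thesis
    unfolding reflect ip_commute[of n "reflect n v x" y]
    using ip_commute[of n x v] ip_commute[of n y v] ip_commute[of n x y] by simp
qed

text \<open>As \<open>v\<close> vanishes below \<open>i\<close>, the reflection acts orthogonally on
  the coordinates from \<open>j\<close> on, for every \<open>j \<le> i\<close>. The case
  \<open>i = j = 0\<close> says that it is an isometry.\<close>

lemma tail_sq_reflect:
  assumes v: "\<And>k. k < i \<Longrightarrow> v k = 0" and "j \<le> i"
  shows "tail_sq n j (reflect n v x) = tail_sq n j x"
proof (cases "ip n v v = 0")
  case False
  define c where "c = 2 * ip n v x / ip n v v"
  have restr: "ip n v y = (\<Sum>k=j..<n. v k * y k)" for y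
    unfolding ip_def using v \<open>j \<le> i\<close> by (intro sum.mono_neutral_right) auto
  have "tail_sq n j (reflect n v x) = (\<Sum>k=j..<n. (x k)\<^sup>2 - 2 * c * (v k * x k) + c\<^sup>2 * (v k * v k))"
    unfolding tail_sq_def reflect_def c_def[symmetric]
    by (intro sum.cong) (auto simp: power2_eq_square algebra_simps)
  also have "\<dots> = tail_sq n j x - 2 * c * ip n v x + c\<^sup>2 * ip n v v"
    by (simp add: tail_sq_def restr sum.distrib sum_subtractf sum_distrib_left)
  also have "2 * c * ip n v x = c\<^sup>2 * ip n v v"
    using False by (simp add: c_def power2_eq_square)
  finally show ?thesis by simp
qed (simp add: reflect_def)

text \<open>A reflection is an isometry and its own inverse, so it carries a plane avoiding the
  reflected balls to one avoiding the original balls.\<close>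

lemma free_plane_reflect:
  assumes free: "free_plane n d r (reflect n v ` G)"
  shows "free_plane n d r G"
proof -
  from free obtain p w where
    indep: "\<And>t. (\<forall>k<n. (\<Sum>j<d. t j * w j k) = 0) \<Longrightarrow> (\<forall>j<d. t j = 0)" and
    far: "\<And>t x. x \<in> G \<Longrightarrow>
      r\<^sup>2 \<le> tail_sq n 0 (\<lambda>k. p k + (\<Sum>j<d. t j * w j k) - reflect n v x k)"
    unfolding free_plane_def by blast
  show ?thesis
    unfolding free_plane_def
  proof (intro exI conjI allI ballI)
    fix t x assume "x \<in> G"
    have "tail_sq n 0 (\<lambda>k. reflect n v p k + (\<Sum>j<d. t j * reflect n v (w j) k) - x k)
      = tail_sq n 0 (reflect n v (\<lambda>k. reflect n v p k + (\<Sum>j<d. t j * reflect n v (w j) k) - x k))"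
      by (rule tail_sq_reflect[of 0, symmetric]) auto
    also have "reflect n v (\<lambda>k. reflect n v p k + (\<Sum>j<d. t j * reflect n v (w j) k) - x k)
      = (\<lambda>k. p k + (\<Sum>j<d. t j * w j k) - reflect n v x k)"
      by (simp add: reflect_diff reflect_add reflect_sum reflect_reflect)
    finally show "r\<^sup>2 \<le> tail_sq n 0 (\<lambda>k. reflect n v p k + (\<Sum>j<d. t j * reflect n v (w j) k) - x k)"
      using far[OF \<open>x \<in> G\<close>] by simp
  next
    fix t
    show "(\<forall>k<n. (\<Sum>j<d. t j * reflect n v (w j) k) = 0) \<longrightarrow> (\<forall>j<d. t j = 0)"
    proof (rule impI, rule indep)
      assume "\<forall>k<n. (\<Sum>j<d. t j * reflect n v (w j) k) = 0"
      hence "tail_sq n 0 (reflect n v (\<lambda>k. \<Sum>j<d. t j * w j k)) = 0"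
        by (simp add: reflect_sum tail_sq_eq_0_iff)
      hence "tail_sq n 0 (\<lambda>k. \<Sum>j<d. t j * w j k) = 0"
        by (simp add: tail_sq_reflect[of 0])
      thus "\<forall>k<n. (\<Sum>j<d. t j * w j k) = 0" by (simp add: tail_sq_eq_0_iff)
    qed
  qed
qed

section \<open>Extending frames by reflections\<close>

context packing_group
begin

lemma packing_group_reflect:
  assumes v: "\<And>k. n \<le> k \<Longrightarrow> v k = 0"
  shows "packing_group n r (reflect n v ` G)"
proof
  show "r > 0" by (rule r_pos)
  have "reflect n v (\<lambda>_. 0) = (\<lambda>_. 0)" by (simp add: reflect_def ip_def)
  with zero_mem show "(\<lambda>_. 0) \<in> reflect n v ` G" by force
  show "(\<lambda>k. x k - y k) \<in> reflect n v ` G" if "x \<in> reflect n v ` G" "y \<in> reflect n v ` G" for x y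
    using that diff_mem by (auto simp flip: reflect_diff)
  show "x k = 0" if "x \<in> reflect n v ` G" "n \<le> k" for x k
    using that v supp by (auto simp: reflect_def)
  show "(2 * r)\<^sup>2 \<le> tail_sq n 0 x" if "x \<in> reflect n v ` G" "x \<noteq> (\<lambda>_. 0)" for x
  proof -
    from that obtain y where y: "y \<in> G" "x = reflect n v y" by auto
    with that \<open>reflect n v (\<lambda>_. 0) = (\<lambda>_. 0)\<close> have "y \<noteq> (\<lambda>_. 0)" by auto
    with separated[OF y(1)] show ?thesis by (simp add: y tail_sq_reflect[of 0])
  qed
  \<comment> \<open>Reflections are self-adjoint, so on the reflected group the functional
    \<open>a\<close> takes the values of \<open>reflect n v a\<close> on \<open>G\<close>.\<close>
  show "\<exists>x\<in>reflect n v ` G. (\<Sum>k<n. a k * x k) \<noteq> 0" if "\<exists>k<n. a k \<noteq> 0" for a :: "nat \<Rightarrow> real"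
  proof -
    from that have "tail_sq n 0 a \<noteq> 0" by (auto simp: tail_sq_eq_0_iff)
    hence "tail_sq n 0 (reflect n v a) \<noteq> 0" by (simp add: tail_sq_reflect[of 0])
    hence "\<exists>k<n. reflect n v a k \<noteq> 0" by (auto simp: tail_sq_eq_0_iff)
    from nondegenerate[OF this] obtain x where "x \<in> G" "ip n (reflect n v a) x \<noteq> 0"
      by (auto simp: ip_def)
    hence "x \<in> G" "ip n a (reflect n v x) \<noteq> 0" by (simp_all add: reflect_self_adjoint)
    thus ?thesis by (auto simp: ip_def)
  qed
qed

text \<open>Reflect so that a shortest nonzero vector of \<open>\<pi>\<^sub>i G\<close> points along
  axis \<open>i\<close>. The reflection vector is supported on the indices from \<open>i\<close> to
  \<open>n - 1\<close>, hence the old frame vectors stay fixed and the minima of the projections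
  \<open>\<pi>\<^sub>j\<close> with \<open>j \<le> i\<close> are unchanged.\<close>

lemma frame_extend:
  assumes fr: "frame i b" and i: "i < n"
  shows "\<exists>v b'. (\<forall>k\<ge>n. v k = 0) \<and> packing_group.frame n (reflect n v ` G) (Suc i) b'"
proof -
  obtain x where x: "x \<in> G" "tail_sq n i x > 0"
    and min: "\<forall>y\<in>G. tail_sq n i y > 0 \<longrightarrow> tail_sq n i x \<le> tail_sq n i y"
    using frame_shortest[OF fr i] by blast
  define l where "l = sqrt (tail_sq n i x)"
  have l: "l > 0" "l\<^sup>2 = tail_sq n i x" using x(2) by (auto simp: l_def)
  \<comment> \<open>The Householder vector for which the reflection maps \<open>\<pi>\<^sub>i x\<close> to \<open>l e\<^sub>i\<close>. If it is zero, then
    division by zero makes \<open>reflect\<close> the identity, as needed.\<close>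
  define v where "v = (\<lambda>k. if i \<le> k \<and> k < n then x k - (if k = i then l else 0) else 0)"
  have v0: "v k = 0" if "k < i \<or> n \<le> k" for k using that by (auto simp: v_def)
  have restr: "ip n v y = (\<Sum>k=i..<n. v k * y k)" for y
    unfolding ip_def by (intro sum.mono_neutral_right) (auto simp: v_def)
  have vx: "ip n v x = l\<^sup>2 - l * x i"
  proof -
    have "ip n v x = (\<Sum>k=i..<n. (x k)\<^sup>2 - (if k = i then l * x i else 0))"
      unfolding restr by (intro sum.cong) (auto simp: v_def power2_eq_square algebra_simps)
    thus ?thesis using i by (simp add: sum_subtractf l(2) tail_sq_def)
  qed
  have "ip n v v = (\<Sum>k=i..<n. v k * x k - (if k = i then l * v i else 0))"
    unfolding restr by (intro sum.cong) (auto simp: v_def algebra_simps)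
  also have "\<dots> = ip n v x - l * v i"
    using i by (simp add: sum_subtractf restr)
  also have "v i = x i - l"
    using i by (simp add: v_def)
  \<comment> \<open>This makes the coefficient in the reflection 1, so that \<open>x\<close> goes to
    \<open>x - v\<close>, which is \<open>l\<close> at index \<open>i\<close> and 0 at the later
    ones.\<close>
  finally have vv: "ip n v v = 2 * ip n v x"
    by (simp add: vx power2_eq_square algebra_simps)
  have refl_x: "reflect n v x k = (if k < i \<or> n \<le> k then x k else if k = i then l else 0)" for k
  proof (cases "ip n v v = 0")
    case True
    hence "v k = 0" using ip_self_eq_0 v0 by (cases "k < n") auto
    moreover have "reflect n v x k = x k" using True by (simp add: reflect_def)
    ultimately show ?thesis by (auto simp: v_def)
  next
    case False
    hence "reflect n v x k = x k - v k" using vv by (simp add: reflect_def)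
    thus ?thesis by (auto simp: v_def)
  qed
  interpret R: packing_group n r "reflect n v ` G"
    by (rule packing_group_reflect) (simp add: v0)
  define b' where "b' = b(i := reflect n v x)"
  have tail: "tail_sq n j (reflect n v y) = tail_sq n j y" if "j \<le> i" for j y
    using v0 that by (intro tail_sq_reflect[of i]) auto
  have "R.frame (Suc i) b'"
    unfolding R.frame_def
  proof (intro allI impI)
    fix j assume "j < Suc i"
    then consider "j < i" | "j = i" by linarith
    thus "b' j \<in> reflect n v ` G \<and> b' j j > 0 \<and> (\<forall>k>j. b' j k = 0) \<and>
      (\<forall>x\<in>reflect n v ` G. tail_sq n j x > 0 \<longrightarrow> (b' j j)\<^sup>2 \<le> tail_sq n j x)"
    proof cases
      case 1
      hence j: "b j \<in> G" "b j j > 0" "\<forall>k>j. b j k = 0"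
        "\<forall>x\<in>G. tail_sq n j x > 0 \<longrightarrow> (b j j)\<^sup>2 \<le> tail_sq n j x"
        using fr by (auto simp: frame_def)
      have "ip n v (b j) = 0"
        using j(3) 1 unfolding restr by (intro sum.neutral) auto
      hence "reflect n v (b j) = b j" by (simp add: reflect_def)
      hence "b j \<in> reflect n v ` G" using j(1) by force
      thus ?thesis using j 1 by (auto simp: b'_def tail)
    next
      case 2
      thus ?thesis using x(1) l min i supp[OF x(1)] by (auto simp: b'_def refl_x tail)
    qed
  qed
  with v0 show ?thesis by (intro exI[of _ v] exI[of _ b'] conjI) simp_all
qed

text \<open>For the plane through \<open>p\<close> parallel to the first \<open>d\<close> axes, the
  distance from \<open>x\<close> is the length of \<open>\<pi>\<^sub>d (p - x)\<close>. A hole of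
  the projected lattice therefore lifts to a plane.\<close>

lemma free_plane_of_hole:
  assumes "d \<le> n" and hole: "\<And>x. x \<in> G \<Longrightarrow> r\<^sup>2 \<le> tail_sq n d (\<lambda>k. p k - x k)"
  shows "free_plane n d r G"
  unfolding free_plane_def
proof (intro exI conjI allI ballI)
  let ?w = "\<lambda>j k. if k = j then 1 else 0 :: real"
  have w: "(\<Sum>j<d. t j * ?w j k) = (if k < d then t k else 0)" for t k
    by (simp add: if_distrib[of "\<lambda>c. _ * c"] cong: if_cong)
  fix t :: "nat \<Rightarrow> real"
  show "(\<forall>k<n. (\<Sum>j<d. t j * ?w j k) = 0) \<longrightarrow> (\<forall>j<d. t j = 0)"
    using \<open>d \<le> n\<close> by (auto simp: w)
  fix x assume "x \<in> G"
  have "r\<^sup>2 \<le> tail_sq n d (\<lambda>k. p k - x k)" by (rule hole) fact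
  also have "\<dots> = tail_sq n d (\<lambda>k. p k + (\<Sum>j<d. t j * ?w j k) - x k)"
    by (intro tail_sq_cong) (simp add: w)
  also have "\<dots> \<le> tail_sq n 0 (\<lambda>k. p k + (\<Sum>j<d. t j * ?w j k) - x k)"
    by (rule tail_sq_mono) simp
  finally show "r\<^sup>2 \<le> tail_sq n 0 (\<lambda>k. p k + (\<Sum>j<d. t j * ?w j k) - x k)" .
qed

end

section \<open>Holes of projected lattices\<close>

lemma separated_points_card:
  fixes u :: "'a \<Rightarrow> 'b \<Rightarrow> real"
  assumes T: "finite T" "T \<noteq> {}"
    and near: "\<And>x. x \<in> T \<Longrightarrow> (\<Sum>k\<in>K. (u x k)\<^sup>2) \<le> R"
    and sep: "\<And>x y. x \<in> T \<Longrightarrow> y \<in> T \<Longrightarrow> x \<noteq> y \<Longrightarrow> L \<le> (\<Sum>k\<in>K. (u x k - u y k)\<^sup>2)"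
  shows "L * (real (card T) - 1) \<le> 2 * R * real (card T)"
proof -
  \<comment> \<open>Blichfeldt: evaluate the sum of all squared mutual distances in two ways.\<close>
  let ?N = "real (card T)"
  have N: "?N > 0" using T by (simp add: card_gt_0_iff)
  have inner: "(\<Sum>x\<in>T. \<Sum>y\<in>T. (u x k - u y k)\<^sup>2) = 2 * ?N * (\<Sum>x\<in>T. (u x k)\<^sup>2) - 2 * (\<Sum>x\<in>T. u x k)\<^sup>2"
    for k
  proof -
    have "(\<Sum>x\<in>T. \<Sum>y\<in>T. (u x k - u y k)\<^sup>2)
        = (\<Sum>x\<in>T. \<Sum>y\<in>T. (u x k)\<^sup>2 + (u y k)\<^sup>2 - 2 * (u x k * u y k))"
      by (simp add: power2_diff mult.assoc)
    also have "\<dots> = 2 * ?N * (\<Sum>x\<in>T. (u x k)\<^sup>2) - 2 * (\<Sum>x\<in>T. \<Sum>y\<in>T. u x k * u y k)"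
      by (simp add: sum.distrib sum_subtractf sum_distrib_left[symmetric])
    also have "(\<Sum>x\<in>T. \<Sum>y\<in>T. u x k * u y k) = (\<Sum>x\<in>T. u x k)\<^sup>2"
      by (simp add: power2_eq_square sum_product)
    finally show ?thesis .
  qed
  have "?N * ((?N - 1) * L) = (\<Sum>x\<in>T. \<Sum>y\<in>T - {x}. L)"
    using T N by (simp add: card_Diff_singleton of_nat_diff)
  also have "\<dots> \<le> (\<Sum>x\<in>T. \<Sum>y\<in>T - {x}. \<Sum>k\<in>K. (u x k - u y k)\<^sup>2)"
    by (intro sum_mono sep) auto
  also have "\<dots> = (\<Sum>x\<in>T. \<Sum>y\<in>T. \<Sum>k\<in>K. (u x k - u y k)\<^sup>2)"
    using T by (intro sum.cong sum.mono_neutral_left) auto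
  also have "\<dots> = (\<Sum>k\<in>K. \<Sum>x\<in>T. \<Sum>y\<in>T. (u x k - u y k)\<^sup>2)"
    by (subst (2) sum.swap, subst sum.swap, rule refl)
  \<comment> \<open>What is dropped is twice the squared coordinate sum, which vanishes when the
    centroid of the points is the origin.\<close>
  also have "\<dots> \<le> (\<Sum>k\<in>K. 2 * ?N * (\<Sum>x\<in>T. (u x k)\<^sup>2))"
    by (intro sum_mono) (simp add: inner)
  also have "\<dots> = 2 * ?N * (\<Sum>x\<in>T. \<Sum>k\<in>K. (u x k)\<^sup>2)"
    by (subst sum.swap) (simp add: sum_distrib_left)
  also have "\<dots> \<le> 2 * ?N * (\<Sum>x\<in>T. R)"
    using N by (intro mult_left_mono sum_mono near) auto
  finally have "?N * ((?N - 1) * L) \<le> ?N * (2 * R * ?N)" by (simp add: algebra_simps)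
  with N show ?thesis by (simp add: mult.commute)
qed

text \<open>With \<open>e = d - i\<close> the quotient of the ball volumes is at most
  \<open>t ^ e\<close>. Squaring removes the roots, the powers of 2 and 4 combine through
  \<open>n - d + e = n - i\<close>, and one factor \<open>2 ^ (n - i)\<close> cancels.\<close>

lemma volume_ratio_bound:
  assumes n: "n \<ge> 3" and i: "i < d" "d < n"
    and vol: "unit_ball_vol (real (n - i)) * sqrt ((1 - 1 / real (2 * n)) / 2) ^ (n - i) * 2 ^ (n - d)
      \<le> 2 * real n * unit_ball_vol (real (n - d))"
  shows "2 ^ n \<le> 8 * (real n)\<^sup>2 * (2 * (real n + 1) / pi) ^ d"
proof -
  define e where "e = d - i"
  define s where "s = sqrt ((1 - 1 / real (2 * n)) / 2)"
  define t where "t = sqrt ((real n + 1) / (2 * pi))"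
  define X where "X = 2 * (real n + 1) / pi"
  have q: "0 \<le> 1 - 1 / real (2 * n)" using n by (simp add: field_simps)
  have s0: "s \<ge> 0" "s\<^sup>2 = (1 - 1 / real (2 * n)) / 2" using q by (simp_all add: s_def)
  have t0: "t \<ge> 0" "t\<^sup>2 = X / 4" by (simp_all add: t_def X_def field_simps)
  have "unit_ball_vol (real (n - d)) \<le> t ^ e * unit_ball_vol (real (n - d + e))"
    unfolding t_def using i by (intro unit_ball_vol_ratio) (auto simp: e_def)
  also have "n - d + e = n - i" using i by (simp add: e_def)
  finally have "2 * real n * unit_ball_vol (real (n - d)) \<le> 2 * real n * (t ^ e * unit_ball_vol (real (n - i)))"
    by (intro mult_left_mono) auto
  note le = order_trans[OF vol[folded s_def] this]
  have "unit_ball_vol (real (n - i)) * (s ^ (n - i) * 2 ^ (n - d))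
      \<le> unit_ball_vol (real (n - i)) * (2 * real n * t ^ e)"
    using le by (simp only: ac_simps)
  hence "s ^ (n - i) * 2 ^ (n - d) \<le> 2 * real n * t ^ e"
    by (simp add: mult_le_cancel_left)
  hence "(s ^ (n - i) * 2 ^ (n - d))\<^sup>2 \<le> (2 * real n * t ^ e)\<^sup>2"
    using s0 by (intro power_mono) auto
  moreover have "(s ^ (n - i))\<^sup>2 = (1 - 1 / real (2 * n)) ^ (n - i) / 2 ^ (n - i)"
    by (simp only: power_mult[symmetric] mult.commute[of _ 2] power_mult[of _ 2] s0 power_divide)
  moreover have "(t ^ e)\<^sup>2 = X ^ e / 4 ^ e"
    by (simp only: power_mult[symmetric] mult.commute[of _ 2] power_mult[of _ 2] t0 power_divide)
  ultimately have "4 ^ e * (((2::real) ^ (n - d))\<^sup>2 * (1 - 1 / real (2 * n)) ^ (n - i))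
      \<le> 2 ^ (n - i) * (4 * (real n)\<^sup>2 * X ^ e)"
    by (simp add: power_mult_distrib field_simps)
  have D: "((2::real) ^ (n - d))\<^sup>2 * 4 ^ e = 2 ^ (n - i) * 2 ^ (n - i)"
  proof -
    have "((2::real) ^ (n - d))\<^sup>2 = 4 ^ (n - d)"
      by (simp add: power2_eq_square flip: power_mult_distrib)
    hence "((2::real) ^ (n - d))\<^sup>2 * 4 ^ e = 4 ^ (n - d + e)"
      by (simp add: power_add)
    also have "n - d + e = n - i" using i by (simp add: e_def)
    finally show ?thesis by (simp flip: power_mult_distrib)
  qed
  with \<open>4 ^ e * _ \<le> _\<close>
  have "2 ^ (n - i) * (2 ^ (n - i) * (1 - 1 / real (2 * n)) ^ (n - i))
      \<le> 2 ^ (n - i) * (4 * (real n)\<^sup>2 * X ^ e)"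
    by (simp only: mult.assoc[symmetric] mult.commute[of "4 ^ e"])
  hence A: "(1 - 1 / real (2 * n)) ^ (n - i) * 2 ^ (n - i) \<le> 4 * (real n)\<^sup>2 * X ^ e"
    by (simp add: mult.commute)
  \<comment> \<open>By Bernoulli, at most \<open>n\<close> powers of \<open>1 - 1 / (2 * n)\<close>
    lose no more than a factor 2. Shrinking the squared radius by that factor is therefore
    harmless.\<close>
  have "1 / 2 \<le> 1 + real (n - i) * (- 1 / real (2 * n))"
    using n by (simp add: field_simps)
  also have "\<dots> \<le> (1 + (- 1 / real (2 * n))) ^ (n - i)"
    using n by (intro Bernoulli_inequality) (simp add: field_simps)
  finally have "1 / 2 * 2 ^ (n - i) \<le> (1 - 1 / real (2 * n)) ^ (n - i) * 2 ^ (n - i)"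
    by (intro mult_right_mono) auto
  with A have B: "2 ^ (n - i) \<le> 8 * (real n)\<^sup>2 * X ^ e" by linarith
  \<comment> \<open>Each of the \<open>i\<close> missing factors 2 is paid for by a factor
    \<open>X\<close>, so the final bound no longer depends on \<open>i\<close>.\<close>
  have "X \<ge> 2" using n pi_less_4 by (simp add: X_def field_simps)
  hence "(2::real) ^ i \<le> X ^ i" by (intro power_mono) auto
  with B \<open>X \<ge> 2\<close> have "2 ^ (n - i) * 2 ^ i \<le> 8 * (real n)\<^sup>2 * X ^ e * X ^ i"
    by (intro mult_mono) auto
  hence "2 ^ n \<le> 8 * (real n)\<^sup>2 * X ^ d"
    using i by (simp add: e_def mult.assoc flip: power_add)
  thus ?thesis by (simp only: X_def)
qed

section \<open>Multiple packing against covering\<close>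

context packing_group
begin

text \<open>By \<open>frame_unique\<close>, distinct members of \<open>T\<close> have distinct
  projections, which are then at least \<open>b i i\<close> apart, while all lie within
  \<open>R\<close> of the projection of \<open>- y\<close>. The choice of \<open>R\<close> turns
  \<open>separated_points_card\<close> into \<open>card T / (2 * n) \<le> 1\<close>. Bounding all
  finite subsets also yields finiteness.\<close>

lemma multiplicity_bound:
  assumes fr: "frame (Suc i) b" and i: "i < n"
    and R: "R\<^sup>2 = (b i i)\<^sup>2 * ((1 - 1 / real (2 * n)) / 2)"
  shows "finite {x\<in>G. shift {..<n} x y \<in> box_ball n i (\<lambda>j. b j j) R} \<and>
    card {x\<in>G. shift {..<n} x y \<in> box_ball n i (\<lambda>j. b j j) R} \<le> 2 * n"
proof (rule finite_if_finite_subsets_card_bdd)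
  have fri: "frame i b" and L: "b i i > 0"
    and min: "\<And>x. x \<in> G \<Longrightarrow> tail_sq n i x > 0 \<Longrightarrow> (b i i)\<^sup>2 \<le> tail_sq n i x"
    using fr by (auto simp: frame_def)
  fix T assume T: "T \<subseteq> {x\<in>G. shift {..<n} x y \<in> box_ball n i (\<lambda>j. b j j) R}" "finite T"
  show "card T \<le> 2 * n"
  proof (cases "T = {}")
    case False
    have box: "0 \<le> y j + x j" "y j + x j < b j j" if "x \<in> T" "j < i" for x j
      using T that i by (auto simp: box_ball_def shift_def)
    have tail: "(\<Sum>k\<in>{i..<n}. (y k + x k)\<^sup>2) \<le> R\<^sup>2" if "x \<in> T" for x
    proof -
      have "(\<Sum>k=i..<n. (shift {..<n} x y k)\<^sup>2) \<le> R\<^sup>2"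
        using T that by (auto simp: box_ball_def)
      also have "(\<Sum>k=i..<n. (shift {..<n} x y k)\<^sup>2) = (\<Sum>k=i..<n. (y k + x k)\<^sup>2)"
        by (intro sum.cong) (auto simp: shift_def)
      finally show ?thesis .
    qed
    have "(b i i)\<^sup>2 * (real (card T) - 1) \<le> 2 * R\<^sup>2 * real (card T)"
    proof (rule separated_points_card[OF _ False tail])
      show "finite T" using T by simp
      fix x z assume xz: "x \<in> T" "z \<in> T" "x \<noteq> z"
      hence G: "x \<in> G" "z \<in> G" using T by auto
      have "tail_sq n i (\<lambda>k. x k - z k) \<noteq> 0"
      proof
        assume "tail_sq n i (\<lambda>k. x k - z k) = 0"
        moreover have "\<bar>x j - z j\<bar> < b j j" if "j < i" for j
          using box[OF xz(1) that] box[OF xz(2) that] by linarith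
        ultimately show False using frame_unique[OF fri G] xz(3) by blast
      qed
      hence "(b i i)\<^sup>2 \<le> tail_sq n i (\<lambda>k. x k - z k)"
        using min[OF diff_mem[OF G]] tail_sq_nonneg[of n i "\<lambda>k. x k - z k"] by linarith
      thus "(b i i)\<^sup>2 \<le> (\<Sum>k=i..<n. (y k + x k - (y k + z k))\<^sup>2)"
        by (simp add: tail_sq_def)
    qed
    also have "\<dots> = (b i i)\<^sup>2 * ((1 - 1 / real (2 * n)) * real (card T))"
      by (simp add: R)
    finally have "real (card T) - 1 \<le> (1 - 1 / real (2 * n)) * real (card T)"
      using L by simp
    hence "real (card T) / real (2 * n) \<le> 1" by (simp add: algebra_simps)
    thus ?thesis using i by (simp add: field_simps)
  qed simp
qed

lemma frame_hole:
  assumes fr: "frame d b" and n: "n \<ge> 3" "1 \<le> d" "d < n"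
    and small: "8 * (real n)\<^sup>2 * (2 * (real n + 1) / pi) ^ d < 2 ^ n"
  shows "\<exists>p. \<forall>x\<in>G. r\<^sup>2 \<le> tail_sq n d (\<lambda>k. p k - x k)"
proof (rule ccontr)
  assume "\<not> ?thesis"
  hence near: "\<exists>x\<in>G. tail_sq n d (\<lambda>k. p k - x k) < r\<^sup>2" for p
    by (auto simp: not_le)
  have b: "b j \<in> G" "b j j > 0" "\<And>k. k > j \<Longrightarrow> b j k = 0" if "j < d" for j
    using fr that by (auto simp: frame_def)
  define l where "l = (\<lambda>j. b j j)"
  \<comment> \<open>The maximal \<open>l i\<close> serves twice:
    \<open>l i \<ge> l 0 \<ge> 2 * r\<close> allows the radius \<open>l i / 2\<close> in the
    covering body, and \<open>l j \<le> l i\<close> bounds its sides from \<open>i\<close> on, so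
    that all powers of \<open>l i\<close> cancel.\<close>
  have "\<exists>i\<in>{..<d}. \<forall>j\<in>{..<d}. l j \<le> l i"
  proof -
    have "Max (l ` {..<d}) \<in> l ` {..<d}" using n by (intro Max_in) (auto simp: lessThan_empty_iff)
    then obtain i where "i < d" "Max (l ` {..<d}) = l i" by auto
    moreover have "l j \<le> Max (l ` {..<d})" if "j < d" for j using that by (intro Max_ge) auto
    ultimately show ?thesis by auto
  qed
  then obtain i where i: "i < d" and li: "\<And>j. j < d \<Longrightarrow> l j \<le> l i" by auto
  have lpos: "l j > 0" if "j < d" for j using b(2)[OF that] by (simp add: l_def)
  have "b 0 0 \<noteq> 0" using b(2)[of 0] n by simp
  hence "b 0 \<noteq> (\<lambda>_. 0)" by (auto simp: fun_eq_iff)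
  have "(2 * r)\<^sup>2 \<le> tail_sq n 0 (b 0)"
    using n b(1) \<open>b 0 \<noteq> (\<lambda>_. 0)\<close> by (intro separated) auto
  also have "\<dots> = (l 0)\<^sup>2"
    unfolding l_def using n b(3) by (intro tail_sq_single) auto
  finally have "2 * r \<le> l 0"
    using lpos[of 0] n by (intro power2_le_imp_le[of "2 * r"]) auto
  with li[of 0] n have rl: "r \<le> l i / 2" by auto
  have li_pos: "l i > 0" by (rule lpos[OF i])
  define s where "s = sqrt ((1 - 1 / real (2 * n)) / 2)"
  have q: "0 < 1 - 1 / real (2 * n)" using n by (simp add: field_simps)
  have s: "s > 0" "s\<^sup>2 = (1 - 1 / real (2 * n)) / 2" using q by (simp_all add: s_def)
  let ?A = "box_ball n d l (l i / 2)" and ?C = "box_ball n i l (l i * s)"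
  let ?M = "lborel_fun {..<n}"
  have "emeasure ?M ?C \<le> of_nat (2 * n) * emeasure ?M ?A"
  proof (rule emeasure_le_multiplicity)
    show "countable G" "infinite G" "finite {..<n}"
      using countable_G infinite_G[OF b(1) \<open>b 0 \<noteq> (\<lambda>_. 0)\<close>] n by auto
    show "?A \<in> sets ?M" "?C \<in> sets ?M"
      using i n by (auto intro: box_ball_measurable)
    fix y :: "nat \<Rightarrow> real" assume y: "y \<in> space ?M"
    have "frame (Suc i) b" using fr i by (auto simp: frame_def)
    from multiplicity_bound[OF this, of "l i * s" y]
    show "finite {x\<in>G. shift {..<n} x y \<in> ?C} \<and> card {x\<in>G. shift {..<n} x y \<in> ?C} \<le> 2 * n"
      using i n by (simp add: l_def power_mult_distrib s(2))
    \<comment> \<open>A lattice point whose projection is close to that of \<open>- y\<close>.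
      Reducing it relative to \<open>- y\<close> moves the first \<open>d\<close> coordinates of
      \<open>y + x\<close> into the box and keeps the projection.\<close>
    from near[of "\<lambda>k. - y k"] obtain x1 where
      x1: "x1 \<in> G" "tail_sq n d (\<lambda>k. - y k - x1 k) < r\<^sup>2" by auto
    from frame_reduce[OF fr x1(1), of "\<lambda>k. - y k"] obtain x where
      x: "x \<in> G" "\<forall>k\<ge>d. x k = x1 k" "\<forall>j<d. - y j \<le> x j \<and> x j < - y j + b j j" by blast
    have "(\<Sum>k=d..<n. (shift {..<n} x y k)\<^sup>2) = tail_sq n d (\<lambda>k. - y k - x1 k)"
      unfolding tail_sq_def using x(2)
      by (intro sum.cong) (auto simp: shift_def power2_eq_square algebra_simps)
    also have "\<dots> \<le> r\<^sup>2" using x1(2) by simp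
    also have "\<dots> \<le> (l i / 2)\<^sup>2" using rl r_pos by (intro power_mono) auto
    finally have "shift {..<n} x y \<in> ?A"
      using x(3) n by (force simp: box_ball_def l_def shift_def space_PiM)
    moreover have "shift {..<n} (\<lambda>k. - (- x k)) y = shift {..<n} x y" by simp
    ultimately show "\<exists>x\<in>G. shift {..<n} (\<lambda>i. - x i) y \<in> ?A"
      using uminus_mem[OF x(1)] by (intro bexI[of _ "\<lambda>k. - x k"]) auto
  qed
  also have "emeasure ?M ?A = ennreal (unit_ball_vol (real (n - d)) * (l i / 2) ^ (n - d) * (\<Prod>j<d. l j))"
    using n li_pos lpos by (intro emeasure_box_ball) (auto simp: less_imp_le)
  also have "emeasure ?M ?C = ennreal (unit_ball_vol (real (n - i)) * (l i * s) ^ (n - i) * (\<Prod>j<i. l j))"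
    using n i li_pos lpos s by (intro emeasure_box_ball) (auto simp: less_imp_le)
  finally have "unit_ball_vol (real (n - i)) * (l i * s) ^ (n - i) * (\<Prod>j<i. l j)
      \<le> 2 * real n * (unit_ball_vol (real (n - d)) * (l i / 2) ^ (n - d) * (\<Prod>j<d. l j))"
    using lpos li_pos
    by (simp add: ennreal_of_nat_eq_real_of_nat ennreal_mult'[symmetric])
      (subst (asm) ennreal_le_iff, auto intro!: mult_nonneg_nonneg prod_nonneg simp: less_imp_le)
  also have "(\<Prod>j<d. l j) = (\<Prod>j<i. l j) * (\<Prod>j=i..<d. l j)"
    using i by (subst prod.union_disjoint[symmetric]) (auto intro!: prod.cong)
  finally have V: "unit_ball_vol (real (n - i)) * (l i * s) ^ (n - i) * (\<Prod>j<i. l j)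
      \<le> 2 * real n * (unit_ball_vol (real (n - d)) * (l i / 2) ^ (n - d)
        * ((\<Prod>j<i. l j) * (\<Prod>j=i..<d. l j)))" .
  \<comment> \<open>The sides below \<open>i\<close> occur in both volumes and cancel; the other
    \<open>d - i\<close> sides of the covering body are replaced by \<open>l i\<close>.\<close>
  have "(\<Prod>j=i..<d. l j) \<le> (\<Prod>j=i..<d. l i)"
    using li lpos by (intro prod_mono) (auto simp: less_imp_le)
  hence "(\<Prod>j=i..<d. l j) \<le> l i ^ (d - i)" by simp
  hence "2 * real n * (unit_ball_vol (real (n - d)) * (l i / 2) ^ (n - d)
        * ((\<Prod>j<i. l j) * (\<Prod>j=i..<d. l j)))
      \<le> 2 * real n * (unit_ball_vol (real (n - d)) * (l i / 2) ^ (n - d)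
        * ((\<Prod>j<i. l j) * l i ^ (d - i)))"
    using lpos li_pos i
    by (intro mult_left_mono mult_nonneg_nonneg prod_nonneg) (auto simp: less_imp_le)
  note order_trans[OF V this]
  moreover have "(\<Prod>j<i. l j) > 0" using lpos i by (intro prod_pos) auto
  moreover have "l i ^ (n - i) = l i ^ (n - d) * l i ^ (d - i)"
    using i n by (simp flip: power_add)
  ultimately have "unit_ball_vol (real (n - i)) * s ^ (n - i) * 2 ^ (n - d)
      \<le> 2 * real n * unit_ball_vol (real (n - d))"
    using li_pos by (simp add: power_mult_distrib power_divide field_simps)
  hence "2 ^ n \<le> 8 * (real n)\<^sup>2 * (2 * (real n + 1) / pi) ^ d"
    unfolding s_def using i n by (intro volume_ratio_bound) auto
  with small show False by simp
qed

end

text \<open>Induction from \<open>i = d\<close> downwards. A full frame yields a hole and hence a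
  plane; a shorter one is extended in a reflected group, whose plane is reflected back.
  \<open>G\<close> and \<open>b\<close> vary because each step changes both.\<close>

lemma free_plane_of_frame:
  assumes n: "n \<ge> 3" "1 \<le> d" "d < n"
    and small: "8 * (real n)\<^sup>2 * (2 * (real n + 1) / pi) ^ d < 2 ^ n"
    and "i \<le> d" "packing_group n r G" "packing_group.frame n G i b"
  shows "free_plane n d r G"
  using assms(5-)
proof (induction i arbitrary: G b rule: inc_induct)
  case base
  interpret packing_group n r G by fact
  show ?case
    using frame_hole[OF base.prems(2) n small] free_plane_of_hole[of d] n by auto
next
  case (step i)
  interpret packing_group n r G by fact
  from frame_extend[OF step.prems(2)] step.hyps n obtain v b' where
    v: "\<forall>k\<ge>n. v k = 0" and b': "packing_group.frame n (reflect n v ` G) (Suc i) b'" by auto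
  have "packing_group n r (reflect n v ` G)"
    using v by (intro packing_group_reflect) auto
  from step.IH[OF this b'] show ?case by (rule free_plane_reflect)
qed

lemma (in packing_group) free_plane_exists:
  assumes "n \<ge> 3" "1 \<le> d" "d < n"
    and "8 * (real n)\<^sup>2 * (2 * (real n + 1) / pi) ^ d < 2 ^ n"
  shows "free_plane n d r G"
  \<comment> \<open>The condition on a frame of length 0 is vacuous, so any \<open>b\<close> will
    do.\<close>
  using assms by (rule free_plane_of_frame[where i = 0 and b = undefined])
    (auto simp: frame_def packing_group_axioms)

section \<open>Lattices in the carrier set of vectors\<close>

text \<open>Extended by 0, so that \<open>supp\<close> holds and the zero vector becomes the zero
  function.\<close>

definition coords :: "nat \<Rightarrow> real vec \<Rightarrow> nat \<Rightarrow> real" where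
  "coords n v = (\<lambda>k. if k < n then vec_index v k else 0)"

lemma eucl_dist_eq_tail_sq:
  "eucl_dist n x y = sqrt (tail_sq n 0 (\<lambda>k. coords n x k - coords n y k))"
  by (auto simp: eucl_dist_def L2_set_def tail_sq_def coords_def atLeast0LessThan intro!: sum.cong)

section \<open>Balls and their interiors\<close>

lemma translate_scaled_ball:
  assumes b: "b \<in> carrier_vec n" and r: "r > 0"
  shows "translate b (scale_set r (unit_ball n)) = {y \<in> carrier_vec n. eucl_dist n b y \<le> r}"
proof -
  interpret Metric_space "carrier_vec n" "eucl_dist n" by (rule Metric_space_eucl_dist)
  have scale: "eucl_dist n b (b + r \<cdot>\<^sub>v u) = r * eucl_dist n (0\<^sub>v n) u" if "u \<in> carrier_vec n" for u
    using that b r by (simp add: eucl_dist_def L2_set_def power_mult_distrib sum_distrib_left[symmetric]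
        real_sqrt_mult)
  show ?thesis
  proof (intro Set.set_eqI iffI)
    fix y assume "y \<in> translate b (scale_set r (unit_ball n))"
    then obtain u where u: "u \<in> carrier_vec n" "eucl_dist n (0\<^sub>v n) u \<le> 1" "y = b + r \<cdot>\<^sub>v u"
      by (auto simp: translate_def scale_set_def unit_ball_def)
    with scale[OF u(1)] b r show "y \<in> {y \<in> carrier_vec n. eucl_dist n b y \<le> r}" by simp
  next
    fix y assume y: "y \<in> {y \<in> carrier_vec n. eucl_dist n b y \<le> r}"
    define u where "u = (1 / r) \<cdot>\<^sub>v (y - b)"
    have u: "u \<in> carrier_vec n" using y b by (simp add: u_def)
    have "b + r \<cdot>\<^sub>v u = y"
      using y b r by (intro eq_vecI) (auto simp: u_def)
    moreover from this scale[OF u] y r have "eucl_dist n (0\<^sub>v n) u \<le> 1" by simp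
    ultimately show "y \<in> translate b (scale_set r (unit_ball n))"
      using u by (force simp: translate_def scale_set_def unit_ball_def)
  qed
qed

lemma eucl_interior_ball:
  assumes b: "b \<in> carrier_vec n" and r: "r > 0"
  shows "eucl_interior n (translate b (scale_set r (unit_ball n))) = {y \<in> carrier_vec n. eucl_dist n b y < r}"
proof -
  interpret Metric_space "carrier_vec n" "eucl_dist n" by (rule Metric_space_eucl_dist)
  have "mtopology interior_of {y \<in> carrier_vec n. eucl_dist n b y \<le> r} = mball b r"
  proof (rule subset_antisym)
    show "mball b r \<subseteq> mtopology interior_of {y \<in> carrier_vec n. eucl_dist n b y \<le> r}"
      by (rule interior_of_maximal) auto
    show "mtopology interior_of {y \<in> carrier_vec n. eucl_dist n b y \<le> r} \<subseteq> mball b r"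
    proof
      fix y assume "y \<in> mtopology interior_of {y \<in> carrier_vec n. eucl_dist n b y \<le> r}"
      then obtain U where U: "openin mtopology U" "y \<in> U"
        "U \<subseteq> {y \<in> carrier_vec n. eucl_dist n b y \<le> r}"
        by (auto simp: interior_of_def)
      then obtain e where e: "e > 0" "mball y e \<subseteq> U" by (auto simp: openin_mtopology)
      from U have y: "y \<in> carrier_vec n" "eucl_dist n b y \<le> r" by auto
      have "eucl_dist n b y \<noteq> r"
      proof
        assume eq: "eucl_dist n b y = r"
        \<comment> \<open>Stretching \<open>y - b\<close> by \<open>1 + c\<close> pushes the
          boundary point out of the ball but moves it only by \<open>e / 2\<close>.\<close>
        define c where "c = e / (2 * r)"
        have c: "c > 0" using e r by (simp add: c_def)
        define z where "z = y + c \<cdot>\<^sub>v (y - b)"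
        have z: "z \<in> carrier_vec n" using y b by (simp add: z_def)
        have "eucl_dist n b z = L2_set (\<lambda>i. (1 + c) * (vec_index b i - vec_index y i)) {..<n}"
          unfolding eucl_dist_def using y b by (intro L2_set_cong) (auto simp: z_def algebra_simps)
        also have "\<dots> = (1 + c) * eucl_dist n b y"
          using c by (simp add: eucl_dist_def L2_set_right_distrib)
        finally have far: "eucl_dist n b z > r" using c r eq by (simp add: algebra_simps)
        have "eucl_dist n y z = L2_set (\<lambda>i. c * (vec_index b i - vec_index y i)) {..<n}"
          unfolding eucl_dist_def using y b by (intro L2_set_cong) (auto simp: z_def algebra_simps)
        also have "\<dots> = c * eucl_dist n b y"
          using c by (simp add: eucl_dist_def L2_set_right_distrib)
        finally have "eucl_dist n y z < e" using e r eq by (simp add: c_def)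
        hence "z \<in> U" using e(2) y z by auto
        with U(3) far show False by auto
      qed
      with y b show "y \<in> mball b r" by simp
    qed
  qed
  moreover have "mball b r = {y \<in> carrier_vec n. eucl_dist n b y < r}"
    using b by (simp add: mball_def)
  ultimately show ?thesis
    by (simp only: eucl_interior_def translate_scaled_ball[OF b r])
qed

lemma packing_group_coords:
  assumes r: "r > 0" and pack: "packing_lattice n (scale_set r (unit_ball n)) \<Lambda>"
  shows "\<Lambda> \<subseteq> carrier_vec n" "packing_group n r (coords n ` \<Lambda>)"
proof -
  from pack obtain B where B: "B \<in> carrier_mat n n" "det B \<noteq> 0"
    and \<Lambda>: "\<Lambda> = (\<lambda>z. B *\<^sub>v map_vec real_of_int z) ` carrier_vec n"
    by (auto simp: packing_lattice_def is_lattice_def)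
  show sub: "\<Lambda> \<subseteq> carrier_vec n" using B(1) by (auto simp: \<Lambda>)
  have zero: "0\<^sub>v n \<in> \<Lambda>"
  proof -
    have "B *\<^sub>v map_vec real_of_int (0\<^sub>v n) = 0\<^sub>v n"
      using B(1) by (intro eq_vecI) (auto simp: scalar_prod_def)
    thus ?thesis unfolding \<Lambda> by (metis imageI zero_carrier_vec)
  qed
  show "packing_group n r (coords n ` \<Lambda>)"
  proof
    show "r > 0" by fact
    have "coords n (0\<^sub>v n) = (\<lambda>_. 0)" by (auto simp: coords_def)
    with zero show "(\<lambda>_. 0) \<in> coords n ` \<Lambda>" by force
  next
    fix x y assume "x \<in> coords n ` \<Lambda>" "y \<in> coords n ` \<Lambda>"
    then obtain u v where uv: "u \<in> carrier_vec n" "v \<in> carrier_vec n"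
      "x = coords n (B *\<^sub>v map_vec real_of_int u)" "y = coords n (B *\<^sub>v map_vec real_of_int v)"
      by (auto simp: \<Lambda>)
    have "(\<lambda>k. x k - y k) = coords n (B *\<^sub>v map_vec real_of_int (u - v))"
      using uv(1,2) B(1)
      by (auto simp: uv(3,4) coords_def scalar_prod_def fun_eq_iff algebra_simps sum_subtractf)
    thus "(\<lambda>k. x k - y k) \<in> coords n ` \<Lambda>"
      using uv(1,2) unfolding \<Lambda> by auto
  next
    fix x k assume "x \<in> coords n ` \<Lambda>" "n \<le> k"
    thus "x k = 0" by (auto simp: coords_def)
  next
    fix x assume "x \<in> coords n ` \<Lambda>" "x \<noteq> (\<lambda>_. 0)"
    then obtain v where v: "v \<in> \<Lambda>" "x = coords n v" by auto
    with sub have vc: "v \<in> carrier_vec n" by auto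
    from \<open>x \<noteq> (\<lambda>_. 0)\<close> have "v \<noteq> 0\<^sub>v n" by (auto simp: v(2) coords_def fun_eq_iff split: if_splits)
    \<comment> \<open>The midpoint of 0 and \<open>v\<close> would be interior to both balls if
      \<open>v\<close> were shorter than \<open>2 * r\<close>.\<close>
    define m where "m = (1/2) \<cdot>\<^sub>v v"
    have m: "m \<in> carrier_vec n" using vc by (simp add: m_def)
    have "m \<notin> eucl_interior n (translate (0\<^sub>v n) (scale_set r (unit_ball n))) \<inter>
        eucl_interior n (translate v (scale_set r (unit_ball n)))"
    proof -
      have "eucl_interior n (translate (0\<^sub>v n) (scale_set r (unit_ball n))) \<inter>
          eucl_interior n (translate v (scale_set r (unit_ball n))) = {}"
        using pack zero v(1) \<open>v \<noteq> 0\<^sub>v n\<close> unfolding packing_lattice_def by metis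
      thus ?thesis by simp
    qed
    hence "\<not> (eucl_dist n (0\<^sub>v n) m < r \<and> eucl_dist n v m < r)"
      using m r vc by (simp add: eucl_interior_ball)
    moreover have "tail_sq n 0 (\<lambda>k. coords n (0\<^sub>v n) k - coords n m k) = tail_sq n 0 x / 4"
      "tail_sq n 0 (\<lambda>k. coords n v k - coords n m k) = tail_sq n 0 x / 4"
      using vc by (auto simp: tail_sq_def coords_def v(2) m_def sum_divide_distrib power_divide
          power2_eq_square field_simps intro!: sum.cong)
    ultimately have "\<not> sqrt (tail_sq n 0 x / 4) < r"
      by (simp add: eucl_dist_eq_tail_sq)
    hence "\<bar>r\<bar> \<le> sqrt (tail_sq n 0 x / 4)" using r by linarith
    hence "r\<^sup>2 \<le> tail_sq n 0 x / 4" by (rule sqrt_ge_absD)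
    thus "(2 * r)\<^sup>2 \<le> tail_sq n 0 x" by (simp add: power_mult_distrib)
  next
    \<comment> \<open>A functional that vanishes on the lattice vanishes on the columns of
      \<open>B\<close>, against the invertibility of \<open>B\<close>.\<close>
    fix a :: "nat \<Rightarrow> real" assume a: "\<exists>k<n. a k \<noteq> 0"
    show "\<exists>x\<in>coords n ` \<Lambda>. (\<Sum>k<n. a k * x k) \<noteq> 0"
    proof (rule ccontr)
      assume "\<not> ?thesis"
      hence orth: "(\<Sum>k<n. a k * coords n v k) = 0" if "v \<in> \<Lambda>" for v using that by auto
      have "B\<^sup>T *\<^sub>v vec n a = 0\<^sub>v n"
      proof (rule eq_vecI)
        fix j assume "j < dim_vec (0\<^sub>v n :: real vec)"
        hence j: "j < n" by simp
        have "B *\<^sub>v map_vec real_of_int (unit_vec n j) \<in> \<Lambda>"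
          unfolding \<Lambda> by (intro imageI) simp
        moreover have "map_vec real_of_int (unit_vec n j) = unit_vec n j"
          by (intro eq_vecI) (auto simp: unit_vec_def)
        moreover have "B *\<^sub>v unit_vec n j = col B j"
          using B(1) j by (intro eq_vecI) auto
        ultimately have "col B j \<in> \<Lambda>" by simp
        from orth[OF this] show "vec_index (B\<^sup>T *\<^sub>v vec n a) j = vec_index (0\<^sub>v n) j"
          using B(1) j by (simp add: scalar_prod_def coords_def atLeast0LessThan mult.commute)
      qed (use B(1) in auto)
      moreover have "vec n a \<noteq> 0\<^sub>v n"
      proof
        assume "vec n a = 0\<^sub>v n"
        hence "vec_index (vec n a) k = 0" if "k < n" for k using that by simp
        with a show False by auto
      qed
      ultimately have "\<exists>v. v \<in> carrier_vec n \<and> v \<noteq> 0\<^sub>v n \<and> B\<^sup>T *\<^sub>v v = 0\<^sub>v n"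
        by (intro exI[of _ "vec n a"] conjI vec_carrier)
      moreover have "B\<^sup>T \<in> carrier_mat n n" using B(1) by simp
      ultimately have "det B\<^sup>T = 0" by (simp only: det_0_iff_vec_prod_zero)
      with B det_transpose[OF B(1)] show False by simp
    qed
  qed
qed

text \<open>Passes from the indexed family \<open>w\<close> to the set \<open>S\<close> of its
  vectors. Independence of the family gives injectivity, so \<open>S\<close> has \<open>d\<close>
  elements, as well as linear independence of the set.\<close>

lemma affine_plane_of_free_plane:
  assumes r: "r > 0" and sub: "\<Lambda> \<subseteq> carrier_vec n" and free: "free_plane n d r (coords n ` \<Lambda>)"
  shows "\<exists>F. affine_plane n d F \<and>
    (\<forall>b\<in>\<Lambda>. F \<inter> eucl_interior n (translate b (scale_set r (unit_ball n))) = {})"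
proof -
  from free obtain p w where pw:
    "(\<forall>t. (\<forall>k<n. (\<Sum>j<d. t j * w j k) = 0) \<longrightarrow> (\<forall>j<d. t j = 0)) \<and>
     (\<forall>t. \<forall>x\<in>coords n ` \<Lambda>. r\<^sup>2 \<le> tail_sq n 0 (\<lambda>k. p k + (\<Sum>j<d. t j * w j k) - x k))"
    unfolding free_plane_def by (elim exE)
  have indep: "t j = 0" if "\<forall>k<n. (\<Sum>j<d. t j * w j k) = 0" "j < d" for t j
    using conjunct1[OF pw, rule_format, of t j] that by simp
  have far: "r\<^sup>2 \<le> tail_sq n 0 (\<lambda>k. p k + (\<Sum>j<d. t j * w j k) - coords n b k)"
    if "b \<in> \<Lambda>" for t b
    using conjunct2[OF pw, rule_format, of "coords n b" t] that by simp
  interpret vec_space "TYPE(real)" n .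
  define ws where "ws j = vec n (w j)" for j
  define S where "S = ws ` {..<d}"
  have S: "S \<subseteq> carrier_vec n" "finite S" by (auto simp: S_def ws_def)
  have inj: "inj_on ws {..<d}"
  proof (rule inj_onI, rule ccontr)
    fix i j assume ij: "i \<in> {..<d}" "j \<in> {..<d}" "ws i = ws j" "i \<noteq> j"
    \<comment> \<open>Two equal vectors at different indices would give this nontrivial
      relation.\<close>
    define t :: "nat \<Rightarrow> real" where "t l = (if l = i then 1 else 0) - (if l = j then 1 else 0)" for l
    have "w i k = w j k" if "k < n" for k
      using ij(3) that unfolding ws_def by (metis index_vec)
    hence "\<forall>k<n. (\<Sum>l<d. t l * w l k) = 0"
      using ij by (simp add: t_def left_diff_distrib sum_subtractf if_distrib[of "\<lambda>c. c * _"] cong: if_cong)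
    from indep[OF this, of i] ij show False by (simp add: t_def)
  qed
  have lincomb: "vec_index (lincomb a S) k = (\<Sum>j<d. a (ws j) * w j k)" if "k < n" for a k
  proof -
    have "vec_index (lincomb a S) k = (\<Sum>x\<in>S. a x * vec_index x k)"
      using that S(1) by (rule lincomb_index)
    also have "\<dots> = (\<Sum>j<d. a (ws j) * vec_index (ws j) k)"
      unfolding S_def by (simp add: sum.reindex[OF inj])
    also have "\<dots> = (\<Sum>j<d. a (ws j) * w j k)"
      using that by (simp add: ws_def)
    finally show ?thesis .
  qed
  have "lin_indpt S"
  proof (rule finite_lin_indpt2)
    fix a assume "lincomb a S = 0\<^sub>v n"
    hence "\<forall>k<n. (\<Sum>j<d. a (ws j) * w j k) = 0"
      by (auto simp flip: lincomb)
    from indep[OF this] show "\<forall>v\<in>S. a v = 0" by (simp add: S_def)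
  qed (use S in simp_all)
  hence "vectorspace.dim class_ring (span_vs S) = card S"
    using S by (intro dim_span) (simp_all add: maximal_def, blast)
  also have "card S = d" unfolding S_def by (simp add: card_image[OF inj])
  finally have dim: "vectorspace.dim class_ring (span_vs S) = d" .
  define F where "F = translate (vec n p) (span S)"
  have "affine_plane n d F"
    unfolding affine_plane_def F_def
    using dim span_is_subspace[OF S(1)] by (intro bexI[of _ "vec n p"] exI[of _ "span S"]) auto
  moreover have "F \<inter> eucl_interior n (translate b (scale_set r (unit_ball n))) = {}" if b: "b \<in> \<Lambda>" for b
  proof (rule ccontr)
    have bc: "b \<in> carrier_vec n" using b sub by auto
    assume "\<not> ?thesis"
    then obtain y where y: "y \<in> F" "eucl_dist n b y < r"
      using eucl_interior_ball[OF bc r] by auto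
    then obtain a where a: "y = vec n p + lincomb a S"
      using finite_span[OF S(2)] S(1) by (auto simp: F_def translate_def)
    have "lincomb a S \<in> carrier_vec n" using lincomb_closed[of S a] S by auto
    hence "tail_sq n 0 (\<lambda>k. coords n b k - coords n y k)
      = tail_sq n 0 (\<lambda>k. p k + (\<Sum>j<d. a (ws j) * w j k) - coords n b k)"
      by (intro tail_sq_cong) (auto simp: a coords_def lincomb power2_commute)
    with far[OF b, of "\<lambda>j. a (ws j)"] have "r\<^sup>2 \<le> tail_sq n 0 (\<lambda>k. coords n b k - coords n y k)"
      by simp
    hence "r \<le> eucl_dist n b y"
      unfolding eucl_dist_eq_tail_sq by (rule real_le_rsqrt)
    with y(2) show False by simp
  qed
  ultimately show ?thesis by blast
qed

theorem theorem1p1: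
  shows "\<exists>n\<^sub>0::nat. \<forall>n\<ge>n\<^sub>0. \<forall>\<Lambda> :: real vec set. \<forall>r::real.
    r > 0 \<and> packing_lattice n (scale_set r (unit_ball n)) \<Lambda> \<longrightarrow>
    (\<exists>F d. affine_plane n d F \<and> real d \<ge> real n / log 2 (real n) \<and>
       (\<forall>b\<in>\<Lambda>. F \<inter> eucl_interior n (translate b (scale_set r (unit_ball n))) = {}))"
proof -
  define d where "d n = nat \<lceil>real n / log 2 (real n)\<rceil>" for n :: nat
  obtain n\<^sub>0 where "\<forall>n\<ge>n\<^sub>0. n \<ge> 3 \<and> d n < n \<and> 1 \<le> d n
     \<and> 8 * (real n)\<^sup>2 * (2 * (real n + 1) / pi) ^ d n < 2 ^ n"
    using eventually_volume_estimate unfolding eventually_sequentially d_def by (elim exE)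
  hence n\<^sub>0: "n \<ge> 3" "1 \<le> d n" "d n < n" "8 * (real n)\<^sup>2 * (2 * (real n + 1) / pi) ^ d n < 2 ^ n"
    if "n \<ge> n\<^sub>0" for n using that by simp_all
  show ?thesis
  proof (intro exI[of _ n\<^sub>0] allI impI)
    fix n \<Lambda> and r :: real
    assume n: "n \<ge> n\<^sub>0" and r: "r > 0 \<and> packing_lattice n (scale_set r (unit_ball n)) \<Lambda>"
    interpret packing_group n r "coords n ` \<Lambda>"
      using r by (intro packing_group_coords) auto
    have "free_plane n (d n) r (coords n ` \<Lambda>)"
      using n\<^sub>0[OF n] by (rule free_plane_exists)
    with r have "\<exists>F. affine_plane n (d n) F \<and>
        (\<forall>b\<in>\<Lambda>. F \<inter> eucl_interior n (translate b (scale_set r (unit_ball n))) = {})"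
      using packing_group_coords(1)[of r n \<Lambda>] by (intro affine_plane_of_free_plane) auto
    moreover have "real (d n) \<ge> real n / log 2 (real n)" unfolding d_def by linarith
    ultimately show "\<exists>F d. affine_plane n d F \<and> real d \<ge> real n / log 2 (real n) \<and>
       (\<forall>b\<in>\<Lambda>. F \<inter> eucl_interior n (translate b (scale_set r (unit_ball n))) = {})" by blast
  qed
qed

end
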